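(* Let $(M,\mathscr{L})$ be an $m$-dimensional pseudo-Finsler space modeled on a pseudo-Minkowski space $(V,L)$, with local vierbein $e^a_\mu(x)$ and commutation coefficients $c^a{}_{bc}(x)$. Then the Douglas curvature, in vierbein components, is given by $$D^r_{abc}=c^e{}_{pq}\,\frac{\partial^3}{\partial y^a\partial y^b\partial y^c}\Big(\big(\tfrac12g^{rp}+\tfrac1{m+1}I^p y^r\big)y_e y^q\Big).$$
   Context: Einstein's summation convention is used. A pseudo-Minkowski space is a pair $(V,L)$ where $V$ is an $m$-dimensional real vector space and $L\colon\bar\omega\to\mathbb{R}$ is defined on the closure of an open cone $\omega\subset V$ with vertex the origin, with $L\in C^4(\omega)\cap C^0(\bar\omega)$, $L(sy)=s^2L(y)$ for $s>0$, and non-degenerate Hessian on $\omega$. A pseudo-Finsler space is a pair $(M,\mathscr{L})$, $\dim M=m$, $\mathscr{L}\colon\bar\Omega\to\mathbb{R}$, $\Omega\subset TM$ projecting onto $M$, such that each $(T_xM,\mathscr{L}_x)$, with $\mathscr{L}_x$ the restriction of $\mathscr{L}$ to the fibre (cone $\Omega_x=\Omega\cap T_xM$), is a pseudo-Minkowski space with signature independent of $x$; the dependence of $\mathscr{L}$ on $x$ is $C^2$. It is modeled on $(V,L)$ if locally, for $x\in U\subset M$, there are linear isomorphisms $\varphi_x\colon T_xM\to V$, sufficiently differentiable in $x$, with $\varphi_x(\Omega_x)=\omega$ and $L(\varphi_x(y))=\mathscr{L}_x(y)$ for every $y\in\bar\Omega_x$. Fix a basis $\{\tilde e_a\}$ of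 $V$ and put $e_a=\varphi_x^{-1}(\tilde e_a)=e^\mu_a\partial_\mu$, with dual basis $e^a=e^a_\mu dx^\mu$ (the vierbein), in local coordinates $x^\mu$ of $M$. A tangent vector is $y=y^\mu\partial_\mu=y^ae_a$, $y^\mu=y^ae^\mu_a$; regarding $L$ as a function of $(y^a)$, $\mathscr{L}(x^\mu,y^\nu)=L(e^a_\nu(x)y^\nu)$. The commutation coefficients are defined by $[e_a,e_b]=c^c{}_{ab}e_c$. With $\partial_a=\partial/\partial y^a$: $y_a=\partial_aL$, $g_{ab}=\partial_a\partial_bL$, $g^{ab}$ the inverse of $g_{ab}$, $C_{abc}=\frac12\partial_a\partial_b\partial_cL$, $I_a=g^{bc}C_{abc}$, $I^a=g^{ab}I_b$. These depend only on $(y^a)$. With $g_{\mu\nu}=\partial^2\mathscr{L}/\partial y^\mu\partial y^\nu$ and inverse $g^{\mu\nu}$, the spray is $G^\mu:=\frac12g^{\mu\sigma}\big(\frac{\partial^2\mathscr{L}}{\partial x^\rho\partial y^\sigma}y^\rho-\frac{\partial\mathscr{L}}{\partial x^\sigma}\big)$ and the coefficients of the non-linear connection are $N^\mu_\alpha:=\partial G^\mu/\partial y^\alpha$. The Douglas curvature is $D^\rho_{\alpha\beta\gamma}:=\frac{\partial^3}{\partial y^\alpha\partial y^\beta\partial y^\gamma}\big(G^\rho-\frac1{m+1}N^\mu_\mu\,y^\rho\big)$, with vierbein components $D^r_{abc}:=D^\rho_{\alpha\beta\gamma}e^r_\rho e^\alpha_ae^\beta_be^\gamma_c$.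
   Formalization: Since L of class C^4 does not ensure that the third derivatives in the formula exist, it is additionally assumed that each function (½g^{rp}+I^p y^r/(m+1)) y_e y^q is C^3 on the cone; this holds whenever L is C^6. *)

theory Defs
  imports "HOL-Analysis.Analysis"
begin

section \<open>Partial derivatives and regularity classes\<close>

definition dir_deriv :: "'v::euclidean_space \<Rightarrow> ('v \<Rightarrow> real) \<Rightarrow> 'v \<Rightarrow> real"
  where "dir_deriv v f x = frechet_derivative f (at x) v"

definition pd :: "'m::finite \<Rightarrow> (real^'m \<Rightarrow> real) \<Rightarrow> real^'m \<Rightarrow> real"
  where "pd i f = dir_deriv (axis i 1) f"

text \<open>Class $C^k$, to be used on open sets \<open>S\<close> only.\<close>

primrec Ck_on :: "nat \<Rightarrow> ('a::euclidean_space \<Rightarrow> 'b::real_normed_vector) \<Rightarrow> 'a set \<Rightarrow> bool" where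
  "Ck_on 0 = (\<lambda>f S. continuous_on S f)"
| "Ck_on (Suc k) = (\<lambda>f S. (\<forall>x\<in>S. f differentiable (at x)) \<and>
      (\<forall>v. Ck_on k (\<lambda>x. frechet_derivative f (at x) v) S))"


section \<open>Pseudo-Minkowski spaces\<close>

text \<open>The inner product of the class \<open>euclidean_space\<close> serves only to provide the canonical topology
  of a finite-dimensional real vector space.  A function on a closed cone is a total function whose
  values outside that cone are irrelevant.\<close>

definition hessian :: "('v::euclidean_space \<Rightarrow> real) \<Rightarrow> 'v \<Rightarrow> 'v \<Rightarrow> 'v \<Rightarrow> real"
  where "hessian L y u w = dir_deriv u (dir_deriv w L) y"

text \<open>The library's \<open>cone\<close> is closed under scaling by 0 as well, which no proper open cone is.\<close>

definition open_cone :: "'v::euclidean_space set \<Rightarrow> bool"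
  where "open_cone \<omega> \<longleftrightarrow> open \<omega> \<and> (\<forall>y\<in>\<omega>. \<forall>s>0. s *\<^sub>R y \<in> \<omega>)"

definition pseudo_minkowski :: "'v::euclidean_space set \<Rightarrow> ('v \<Rightarrow> real) \<Rightarrow> bool" where
  "pseudo_minkowski \<omega> L \<longleftrightarrow>
     open_cone \<omega> \<and> Ck_on 4 L \<omega> \<and> continuous_on (closure \<omega>) L \<and>
     (\<forall>y\<in>closure \<omega>. \<forall>s>0. L (s *\<^sub>R y) = s\<^sup>2 * L y) \<and>
     (\<forall>y\<in>\<omega>. \<forall>u. (\<forall>w. hessian L y u w = 0) \<longrightarrow> u = 0)"

definition pos_index :: "('v::euclidean_space \<Rightarrow> 'v \<Rightarrow> real) \<Rightarrow> nat"
  where "pos_index B = Max {dim S |S. subspace S \<and> (\<forall>v\<in>S. v \<noteq> 0 \<longrightarrow> B v v > 0)}"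

definition signature :: "('v::euclidean_space \<Rightarrow> 'v \<Rightarrow> real) \<Rightarrow> nat \<times> nat"
  where "signature B = (pos_index B, pos_index (\<lambda>u w. - B u w))"

text \<open>The cone need not be connected, so the Hessian may have several signatures.  If it has only
  one, this set is the singleton of the signature of the pseudo-Minkowski space.\<close>

definition signatures :: "'v::euclidean_space set \<Rightarrow> ('v \<Rightarrow> real) \<Rightarrow> (nat \<times> nat) set"
  where "signatures \<omega> L = (\<lambda>y. signature (hessian L y)) ` \<omega>"


section \<open>Manifolds and tangent vectors\<close>

type_synonym ('p, 'm) chart = "'p set \<times> ('p \<Rightarrow> real^'m)"

abbreviation chart_inv :: "('p, 'm::finite) chart \<Rightarrow> real^'m \<Rightarrow> 'p"
  where "chart_inv c \<equiv> inv_into (fst c) (snd c)"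

definition transition :: "('p, 'm::finite) chart \<Rightarrow> ('p, 'm) chart \<Rightarrow> real^'m \<Rightarrow> real^'m"
  where "transition c d = snd d \<circ> chart_inv c"

definition smooth_manifold :: "'p topology \<Rightarrow> ('p, 'm::finite) chart set \<Rightarrow> bool" where
  "smooth_manifold M A \<longleftrightarrow>
     Hausdorff_space M \<and> second_countable M \<and> (\<Union>c\<in>A. fst c) = topspace M \<and>
     (\<forall>c\<in>A. openin M (fst c) \<and> open (snd c ` fst c) \<and>
        homeomorphic_map (subtopology M (fst c)) (top_of_set (snd c ` fst c)) (snd c)) \<and>
     (\<forall>c\<in>A. \<forall>d\<in>A. \<forall>k. Ck_on k (transition c d) (snd c ` (fst c \<inter> fst d)))"

text \<open>A tangent vector at \<open>p\<close> assigns to every chart around \<open>p\<close> a tuple of components, subject to the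
  transformation law of contravariant vectors (and 0 to all other charts, so that equal tangent
  vectors are equal functions).  The linear structure is pointwise.\<close>

type_synonym ('p, 'm) tangent = "('p, 'm) chart \<Rightarrow> real^'m"

definition tangent_space :: "('p, 'm::finite) chart set \<Rightarrow> 'p \<Rightarrow> ('p, 'm) tangent set" where
  "tangent_space A p = {v.
     (\<forall>c\<in>A. \<forall>d\<in>A. p \<in> fst c \<longrightarrow> p \<in> fst d \<longrightarrow>
        v d = frechet_derivative (transition c d) (at (snd c p)) (v c)) \<and>
     (\<forall>c. \<not> (c \<in> A \<and> p \<in> fst c) \<longrightarrow> v c = 0)}"

text \<open>The tangent vector $u^\mu\partial_\mu$ at \<open>p\<close>, where \<open>\<partial>\<^sub>\<mu>\<close> are the coordinate fields of the chart \<open>c\<close>.\<close>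

definition tangent_of :: "('p, 'm::finite) chart set \<Rightarrow> ('p, 'm) chart \<Rightarrow> 'p \<Rightarrow> real^'m \<Rightarrow> ('p, 'm) tangent"
  where "tangent_of A c p u = (\<lambda>d. if d \<in> A \<and> p \<in> fst d
           then frechet_derivative (transition c d) (at (snd c p)) u else 0)"

definition tangent_bundle :: "'p topology \<Rightarrow> ('p, 'm::finite) chart set \<Rightarrow> ('p \<times> ('p, 'm) tangent) set"
  where "tangent_bundle M A = (SIGMA p:topspace M. tangent_space A p)"

text \<open>Closure in the finite-dimensional vector space \<open>tangent_space A p\<close>.\<close>

definition tangent_closure :: "('p, 'm::finite) chart set \<Rightarrow> 'p \<Rightarrow> ('p, 'm) tangent set \<Rightarrow> ('p, 'm) tangent set"
  where "tangent_closure A p S =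
    {v \<in> tangent_space A p. \<forall>c\<in>A. p \<in> fst c \<longrightarrow> v c \<in> closure ((\<lambda>w. w c) ` S)}"

definition lie_bracket :: "('p, 'm::finite) chart set \<Rightarrow> ('p \<Rightarrow> ('p, 'm) tangent) \<Rightarrow>
    ('p \<Rightarrow> ('p, 'm) tangent) \<Rightarrow> 'p \<Rightarrow> ('p, 'm) tangent" where
  "lie_bracket A X Y p = (\<lambda>c. if c \<in> A \<and> p \<in> fst c
     then \<chi> \<mu>. \<Sum>\<nu>\<in>UNIV. X p c $ \<nu> * pd \<nu> (\<lambda>\<xi>. Y (chart_inv c \<xi>) c $ \<mu>) (snd c p)
                      - Y p c $ \<nu> * pd \<nu> (\<lambda>\<xi>. X (chart_inv c \<xi>) c $ \<mu>) (snd c p)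
     else 0)"


section \<open>Pseudo-Finsler spaces\<close>

definition fibre :: "('p \<times> 'w) set \<Rightarrow> 'p \<Rightarrow> 'w set"
  where "fibre \<Omega> p = {v. (p, v) \<in> \<Omega>}"

text \<open>\<open>\<Omega>\<close> and \<open>\<L>\<close> in the coordinates $(x^\mu, y^\mu)$ of the tangent bundle induced by a chart \<open>c\<close>.\<close>

definition coord_dom :: "('p, 'm::finite) chart set \<Rightarrow> ('p \<times> ('p, 'm) tangent) set \<Rightarrow>
    ('p, 'm) chart \<Rightarrow> ((real^'m) \<times> (real^'m)) set" where
  "coord_dom A \<Omega> c = {(\<xi>, u). \<xi> \<in> snd c ` fst c \<and> (chart_inv c \<xi>, tangent_of A c (chart_inv c \<xi>) u) \<in> \<Omega>}"

definition coord_fun :: "('p, 'm::finite) chart set \<Rightarrow> ('p \<times> ('p, 'm) tangent \<Rightarrow> real) \<Rightarrow>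
    ('p, 'm) chart \<Rightarrow> real^'m \<Rightarrow> real^'m \<Rightarrow> real" where
  "coord_fun A \<L> c \<xi> u = \<L> (chart_inv c \<xi>, tangent_of A c (chart_inv c \<xi>) u)"

text \<open>That \<open>\<Omega>\<close> is open in the tangent bundle gives a meaning to the derivatives of \<open>\<L>\<close> in \<open>x\<close>; it holds
  automatically for spaces modeled on a pseudo-Minkowski space.\<close>

definition pseudo_finsler :: "'p topology \<Rightarrow> ('p, 'm::finite) chart set \<Rightarrow>
    ('p \<times> ('p, 'm) tangent) set \<Rightarrow> ('p \<times> ('p, 'm) tangent \<Rightarrow> real) \<Rightarrow> bool" where
  "pseudo_finsler M A \<Omega> \<L> \<longleftrightarrow>
     smooth_manifold M A \<and> \<Omega> \<subseteq> tangent_bundle M A \<and> fst ` \<Omega> = topspace M \<and>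
     (\<forall>c\<in>A. open (coord_dom A \<Omega> c)) \<and>
     (\<forall>c\<in>A. \<forall>\<xi> \<in> snd c ` fst c. pseudo_minkowski (fibre (coord_dom A \<Omega> c) \<xi>) (coord_fun A \<L> c \<xi>)) \<and>
     (\<exists>\<Sigma>. \<forall>c\<in>A. \<forall>\<xi> \<in> snd c ` fst c. signatures (fibre (coord_dom A \<Omega> c) \<xi>) (coord_fun A \<L> c \<xi>) = \<Sigma>) \<and>
     (\<forall>c\<in>A. \<forall>u. Ck_on 2 (\<lambda>\<xi>. coord_fun A \<L> c \<xi> u) {\<xi>. (\<xi>, u) \<in> coord_dom A \<Omega> c})"

definition tangent_iso :: "('p, 'm::finite) chart set \<Rightarrow> 'p \<Rightarrow> (('p, 'm) tangent \<Rightarrow> 'v::euclidean_space) \<Rightarrow> bool"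
  where "tangent_iso A p f \<longleftrightarrow> bij_betw f (tangent_space A p) UNIV \<and>
    (\<forall>v\<in>tangent_space A p. \<forall>w\<in>tangent_space A p. \<forall>s t.
       f (\<lambda>c. s *\<^sub>R v c + t *\<^sub>R w c) = s *\<^sub>R f v + t *\<^sub>R f w)"

text \<open>The isomorphisms are required to be $C^1$ in \<open>x\<close>, which is what it takes for the commutation
  coefficients to be defined.\<close>

definition local_model :: "'p topology \<Rightarrow> ('p, 'm::finite) chart set \<Rightarrow>
    ('p \<times> ('p, 'm) tangent) set \<Rightarrow> ('p \<times> ('p, 'm) tangent \<Rightarrow> real) \<Rightarrow>
    'v::euclidean_space set \<Rightarrow> ('v \<Rightarrow> real) \<Rightarrow> 'p set \<Rightarrow> ('p \<Rightarrow> ('p, 'm) tangent \<Rightarrow> 'v) \<Rightarrow> bool" where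
  "local_model M A \<Omega> \<L> \<omega> L U \<phi> \<longleftrightarrow>
     openin M U \<and>
     (\<forall>x\<in>U. tangent_iso A x (\<phi> x) \<and> \<phi> x ` fibre \<Omega> x = \<omega> \<and>
        (\<forall>y \<in> tangent_closure A x (fibre \<Omega> x). L (\<phi> x y) = \<L> (x, y))) \<and>
     (\<forall>c\<in>A. \<forall>u. Ck_on 1 (\<lambda>\<xi>. \<phi> (chart_inv c \<xi>) (tangent_of A c (chart_inv c \<xi>) u))
        (snd c ` (fst c \<inter> U)))"

definition modeled_on :: "'p topology \<Rightarrow> ('p, 'm::finite) chart set \<Rightarrow>
    ('p \<times> ('p, 'm) tangent) set \<Rightarrow> ('p \<times> ('p, 'm) tangent \<Rightarrow> real) \<Rightarrow>
    'v::euclidean_space set \<Rightarrow> ('v \<Rightarrow> real) \<Rightarrow> bool" where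
  "modeled_on M A \<Omega> \<L> \<omega> L \<longleftrightarrow> (\<forall>x\<in>topspace M. \<exists>U \<phi>. x \<in> U \<and> local_model M A \<Omega> \<L> \<omega> L U \<phi>)"


section \<open>The vierbein\<close>

definition is_basis :: "('m::finite \<Rightarrow> 'v::euclidean_space) \<Rightarrow> bool"
  where "is_basis e \<longleftrightarrow> inj e \<and> independent (range e) \<and> span (range e) = UNIV"

definition frame :: "('p, 'm::finite) chart set \<Rightarrow> ('p \<Rightarrow> ('p, 'm) tangent \<Rightarrow> 'v) \<Rightarrow> ('m \<Rightarrow> 'v) \<Rightarrow>
    'm \<Rightarrow> 'p \<Rightarrow> ('p, 'm) tangent"
  where "frame A \<phi> e a x = inv_into (tangent_space A x) (\<phi> x) (e a)"

text \<open>\<open>frame_mat \<dots> $ \<mu> $ a\<close> is $e^\mu_a$ and \<open>coframe_mat \<dots> $ a $ \<mu>\<close> is $e^a_\mu$, in the chart \<open>c\<close>.\<close>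

definition frame_mat :: "('p, 'm::finite) chart set \<Rightarrow> ('p \<Rightarrow> ('p, 'm) tangent \<Rightarrow> 'v) \<Rightarrow> ('m \<Rightarrow> 'v) \<Rightarrow>
    ('p, 'm) chart \<Rightarrow> 'p \<Rightarrow> real^'m^'m"
  where "frame_mat A \<phi> e c x = (\<chi> \<mu> a. frame A \<phi> e a x c $ \<mu>)"

definition coframe_mat :: "('p, 'm::finite) chart set \<Rightarrow> ('p \<Rightarrow> ('p, 'm) tangent \<Rightarrow> 'v) \<Rightarrow> ('m \<Rightarrow> 'v) \<Rightarrow>
    ('p, 'm) chart \<Rightarrow> 'p \<Rightarrow> real^'m^'m"
  where "coframe_mat A \<phi> e c x = matrix_inv (frame_mat A \<phi> e c x)"

text \<open>\<open>cc x k a b\<close> is $c^k{}_{ab}(x)$, determined by $[e_a,e_b]=c^k{}_{ab}e_k$.\<close>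

definition commutation_coeffs :: "('p, 'm::finite) chart set \<Rightarrow> 'p set \<Rightarrow>
    ('p \<Rightarrow> ('p, 'm) tangent \<Rightarrow> 'v) \<Rightarrow> ('m \<Rightarrow> 'v) \<Rightarrow> ('p \<Rightarrow> 'm \<Rightarrow> 'm \<Rightarrow> 'm \<Rightarrow> real) \<Rightarrow> bool" where
  "commutation_coeffs A U \<phi> e cc \<longleftrightarrow> (\<forall>x\<in>U. \<forall>a b.
     lie_bracket A (frame A \<phi> e a) (frame A \<phi> e b) x =
       (\<lambda>d. \<Sum>k\<in>UNIV. cc x k a b *\<^sub>R frame A \<phi> e k x d))"


section \<open>Tensors of a Lagrangian of \<open>y\<close> alone\<close>

definition metric :: "(real^'m \<Rightarrow> real) \<Rightarrow> real^'m \<Rightarrow> real^'m::finite^'m"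
  where "metric L y = (\<chi> a b. pd a (pd b L) y)"

definition metric_inv :: "(real^'m \<Rightarrow> real) \<Rightarrow> real^'m \<Rightarrow> real^'m::finite^'m"
  where "metric_inv L y = matrix_inv (metric L y)"

definition cartan :: "(real^'m \<Rightarrow> real) \<Rightarrow> 'm::finite \<Rightarrow> 'm \<Rightarrow> 'm \<Rightarrow> real^'m \<Rightarrow> real"
  where "cartan L a b c y = 1/2 * pd a (pd b (pd c L)) y"

definition mean_cartan :: "(real^'m \<Rightarrow> real) \<Rightarrow> 'm::finite \<Rightarrow> real^'m \<Rightarrow> real"
  where "mean_cartan L a y = (\<Sum>b\<in>UNIV. \<Sum>c\<in>UNIV. metric_inv L y $ b $ c * cartan L a b c y)"

definition mean_cartan_up :: "(real^'m \<Rightarrow> real) \<Rightarrow> 'm::finite \<Rightarrow> real^'m \<Rightarrow> real"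
  where "mean_cartan_up L a y = (\<Sum>b\<in>UNIV. metric_inv L y $ a $ b * mean_cartan L b y)"


section \<open>Spray, non-linear connection and Douglas curvature in local coordinates\<close>

text \<open>Here \<open>F x y\<close> is the Lagrangian in the coordinates $(x^\mu,y^\mu)$.\<close>

definition spray :: "(real^'m \<Rightarrow> real^'m \<Rightarrow> real) \<Rightarrow> 'm::finite \<Rightarrow> real^'m \<Rightarrow> real^'m \<Rightarrow> real" where
  "spray F \<mu> x y = 1/2 * (\<Sum>\<sigma>\<in>UNIV. metric_inv (F x) y $ \<mu> $ \<sigma> *
     ((\<Sum>\<rho>\<in>UNIV. pd \<rho> (\<lambda>x'. pd \<sigma> (F x') y) x * y $ \<rho>) - pd \<sigma> (\<lambda>x'. F x' y) x))"

definition nonlinear_conn :: "(real^'m \<Rightarrow> real^'m \<Rightarrow> real) \<Rightarrow> 'm::finite \<Rightarrow> 'm \<Rightarrow> real^'m \<Rightarrow> real^'m \<Rightarrow> real"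
  where "nonlinear_conn F \<mu> \<alpha> x y = pd \<alpha> (spray F \<mu> x) y"

definition douglas :: "(real^'m \<Rightarrow> real^'m \<Rightarrow> real) \<Rightarrow> 'm::finite \<Rightarrow> 'm \<Rightarrow> 'm \<Rightarrow> 'm \<Rightarrow> real^'m \<Rightarrow> real^'m \<Rightarrow> real" where
  "douglas F \<rho> \<alpha> \<beta> \<gamma> x y = pd \<alpha> (pd \<beta> (pd \<gamma>
     (\<lambda>z. spray F \<rho> x z - 1 / (real CARD('m) + 1) * (\<Sum>\<mu>\<in>UNIV. nonlinear_conn F \<mu> \<mu> x z) * z $ \<rho>))) y"

text \<open>\<open>E $ \<mu> $ a\<close> is $e^\mu_a$ and \<open>E' $ a $ \<mu>\<close> is $e^a_\mu$.\<close>

definition douglas_frame :: "(real^'m \<Rightarrow> real^'m \<Rightarrow> real) \<Rightarrow> real^'m^'m \<Rightarrow> real^'m^'m \<Rightarrow>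
    'm::finite \<Rightarrow> 'm \<Rightarrow> 'm \<Rightarrow> 'm \<Rightarrow> real^'m \<Rightarrow> real^'m \<Rightarrow> real" where
  "douglas_frame F E E' r a b c x y =
     (\<Sum>\<rho>\<in>UNIV. \<Sum>\<alpha>\<in>UNIV. \<Sum>\<beta>\<in>UNIV. \<Sum>\<gamma>\<in>UNIV.
        douglas F \<rho> \<alpha> \<beta> \<gamma> x y * E' $ r $ \<rho> * E $ \<alpha> $ a * E $ \<beta> $ b * E $ \<gamma> $ c)"

text \<open>\<open>lin_comb e y\<close> is the vector $y^a\tilde e_a$.\<close>

definition lin_comb :: "('m::finite \<Rightarrow> 'v::real_vector) \<Rightarrow> real^'m \<Rightarrow> 'v"
  where "lin_comb e y = (\<Sum>a\<in>UNIV. y $ a *\<^sub>R e a)"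

text \<open>\<open>L\<close> regarded as a function of $(y^a)$.\<close>

definition in_basis :: "('m::finite \<Rightarrow> 'v::real_vector) \<Rightarrow> ('v \<Rightarrow> real) \<Rightarrow> real^'m \<Rightarrow> real"
  where "in_basis e L = (\<lambda>y. L (lin_comb e y))"

text \<open>The function $\big(\frac12 g^{rp}+\frac1{m+1}I^p y^r\big)\,y_e\,y^q$ of $(y^a)$.\<close>

definition douglas_potential :: "(real^'m \<Rightarrow> real) \<Rightarrow> 'm::finite \<Rightarrow> 'm \<Rightarrow> 'm \<Rightarrow> 'm \<Rightarrow> real^'m \<Rightarrow> real" where
  "douglas_potential L r p e q y =
     (1/2 * metric_inv L y $ r $ p + 1 / (real CARD('m) + 1) * mean_cartan_up L p y * y $ r)
       * pd e L y * y $ q"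

end

theory Submission
  imports Defs
begin

text \<open>In a chart, the Lagrangian is \<open>F(x, u) = L(B(x) u)\<close> with the coframe matrix \<open>B = (e\<^sup>a\<^sub>\<mu>)\<close>.
  Inserting this into the spray and passing to \<open>y = B u\<close> gives \<open>G\<^sup>\<mu> = e\<^sup>\<mu>\<^sub>r G\<^sup>r(y)\<close>, where
  \<open>G\<^sup>r = 1/2 g\<^sup>r\<^sup>p c\<^sup>e\<^sub>p\<^sub>q y\<^sub>e y\<^sup>q\<close> up to a quadratic form in \<open>y\<close>.  The trace of the non-linear connection is the divergence
  of \<open>G\<^sup>r\<close>.  Since the divergence of \<open>g\<^sup>r\<^sup>p\<close> is \<open>- 2 I\<^sup>p\<close> and \<open>c\<close> is antisymmetric, this trace is
  \<open>- I\<^sup>p c\<^sup>e\<^sub>p\<^sub>q y\<^sub>e y\<^sup>q\<close> up to a linear form.  The third derivatives kill the quadratic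
  remainders, and they are tensorial under the change of variable \<open>y = B u\<close>, which is linear in \<open>u\<close>.\<close>


section \<open>Partial derivatives\<close>

text \<open>The obstacle is regularity. The trace of the non-linear connection contains the mean
  Cartan tensor, hence third derivatives of \<open>L\<close>, so C^4 alone makes it only C^1, while
  the Douglas curvature takes three further derivatives of it. The C^3 assumption concerns the
  potentials as wholes, not their two summands. The spray is therefore differentiated just once, to
  get its divergence; spray and trace term are then recombined into a constant combination of
  potentials and quadratic monomials, and only this combination is differentiated three times. The
  derivative of \<open>B\<close> enters the spray in two ways. Through the argument of
  \<open>L\<close> it comes with the Hessian \<open>g_ab\<close>, which the inverse metric cancels;
  what remains is a quadratic form that does not involve \<open>L\<close>. Elsewhere it enters
  antisymmetrised, as the exterior derivative of the coframe, which in the frame is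
  \<open>- c\<close>.\<close>

lemma dir_deriv_eq: "(f has_derivative f') (at x) \<Longrightarrow> dir_deriv v f x = f' v"
  unfolding dir_deriv_def by (metis frechet_derivative_at)

lemma pd_eq: "(f has_derivative f') (at x) \<Longrightarrow> pd i f x = f' (axis i 1)"
  unfolding pd_def by (rule dir_deriv_eq)

lemma has_derivative_pd:
  fixes f :: "real^'m::finite \<Rightarrow> real"
  assumes "f differentiable (at x)"
  shows "(f has_derivative (\<lambda>h. \<Sum>i\<in>UNIV. pd i f x * h $ i)) (at x)"
proof -
  let ?D = "frechet_derivative f (at x)"
  have D: "(f has_derivative ?D) (at x)"
    using assms frechet_derivative_works by blast
  then have lin: "linear ?D" by (rule has_derivative_linear)
  have "?D h = (\<Sum>i\<in>UNIV. pd i f x * h $ i)" for h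
  proof -
    have "?D h = ?D (\<Sum>i\<in>UNIV. h $ i *\<^sub>R axis i 1)"
      using basis_expansion[of h] by (simp add: scalar_mult_eq_scaleR)
    also have "\<dots> = (\<Sum>i\<in>UNIV. h $ i *\<^sub>R ?D (axis i 1))"
      by (simp add: linear_sum[OF lin] linear_cmul[OF lin])
    finally show ?thesis by (simp add: pd_def dir_deriv_def mult.commute)
  qed
  then have "?D = (\<lambda>h. \<Sum>i\<in>UNIV. pd i f x * h $ i)" by auto
  with D show ?thesis by simp
qed

text \<open>Both functions have the same set of derivatives at \<open>x\<close>, so the choice
  operator in \<open>frechet_derivative\<close> picks the same one. Hence no differentiability is
  assumed, and nested derivatives as in \<open>douglas\<close> can be rewritten before their
  existence is known.\<close>

lemma dir_deriv_cong:
  assumes "open S" "x \<in> S" "\<And>z. z \<in> S \<Longrightarrow> f z = g z"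
  shows "dir_deriv v f x = dir_deriv v g x"
proof -
  have "(f has_derivative D) (at x) \<longleftrightarrow> (g has_derivative D) (at x)" for D
    using assms has_derivative_transform_within_open[of f D x UNIV S g]
      has_derivative_transform_within_open[of g D x UNIV S f] by auto
  then show ?thesis unfolding dir_deriv_def frechet_derivative_def by simp
qed

lemma pd_cong:
  assumes "open S" "x \<in> S" "\<And>z. z \<in> S \<Longrightarrow> f z = g z"
  shows "pd i f x = pd i g x"
  unfolding pd_def using assms by (rule dir_deriv_cong)

lemma pd_compose:
  fixes f :: "real^'m::finite \<Rightarrow> real" and g :: "real^'n::finite \<Rightarrow> real^'m"
  assumes "f differentiable (at (g x))" "(g has_derivative g') (at x)"
  shows "pd i (\<lambda>z. f (g z)) x = (\<Sum>a\<in>UNIV. pd a f (g x) * g' (axis i 1) $ a)"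
  by (rule pd_eq[OF has_derivative_compose[OF assms(2) has_derivative_pd[OF assms(1)]]])

lemma pd_compose_linear:
  fixes f :: "real^'m::finite \<Rightarrow> real" and B :: "real^'n::finite^'m"
  assumes "f differentiable (at (B *v x))"
  shows "pd i (\<lambda>z. f (B *v z)) x = (\<Sum>a\<in>UNIV. B $ a $ i * pd a f (B *v x))"
proof -
  have "((\<lambda>z. B *v z) has_derivative (\<lambda>z. B *v z)) (at x)"
    by (rule linear_imp_has_derivative) simp
  from pd_compose[OF assms this] show ?thesis
    by (simp add: matrix_vector_mult_basis column_def mult.commute)
qed

lemma pd_mult:
  assumes "f differentiable (at x)" "g differentiable (at x)"
  shows "pd i (\<lambda>z. f z * g z) x = f x * pd i g x + pd i f x * g x"
  using pd_eq[OF has_derivative_mult[OF has_derivative_pd[OF assms(1)] has_derivative_pd[OF assms(2)]]]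
  by (simp add: axis_def if_distrib cong: if_cong)

lemma pd_add:
  assumes "f differentiable (at x)" "g differentiable (at x)"
  shows "pd i (\<lambda>z. f z + g z) x = pd i f x + pd i g x"
  using pd_eq[OF has_derivative_add[OF has_derivative_pd[OF assms(1)] has_derivative_pd[OF assms(2)]]]
  by (simp add: axis_def if_distrib cong: if_cong)

lemma pd_cmult:
  assumes "f differentiable (at x)"
  shows "pd i (\<lambda>z. k * f z) x = k * pd i f x"
  using pd_eq[OF has_derivative_mult_right[OF has_derivative_pd[OF assms]]]
  by (simp add: axis_def if_distrib cong: if_cong)

lemma pd_sum:
  assumes "\<And>j. j \<in> J \<Longrightarrow> f j differentiable (at x)"
  shows "pd i (\<lambda>z. \<Sum>j\<in>J. f j z) x = (\<Sum>j\<in>J. pd i (f j) x)"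
  using pd_eq[OF has_derivative_sum[OF has_derivative_pd[OF assms]]]
  by (simp add: axis_def if_distrib cong: if_cong)

lemma has_derivative_nth: "((\<lambda>z. z $ j) has_derivative (\<lambda>h. h $ j)) (at (x :: real^'m::finite))"
  by (rule bounded_linear_imp_has_derivative) (rule bounded_linear_vec_nth)

lemma pd_nth: "pd i (\<lambda>z. z $ j) x = (if i = j then 1 else 0)"
  by (subst pd_eq[OF has_derivative_nth]) (simp add: axis_def)

lemma differentiable_nth [simp]: "(\<lambda>z. z $ j) differentiable (at (x :: real^'m::finite))"
  using has_derivative_nth differentiableI by blast

section \<open>Calculus of the classes C^k on open sets\<close>

lemma Ck_on_cong:
  assumes "open S" "\<And>x. x \<in> S \<Longrightarrow> f x = g x" "Ck_on k f S"
  shows "Ck_on k g S"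
  using assms(2,3)
proof (induction k arbitrary: f g)
  case 0
  then show ?case using continuous_on_cong by fastforce
next
  case (Suc k)
  have tr: "(g has_derivative D) (at x)" if "x \<in> S" "(f has_derivative D) (at x)" for x D
    using has_derivative_transform_within_open[OF that(2) assms(1) that(1) Suc.prems(1)] by auto
  have "g differentiable (at x)" if "x \<in> S" for x
  proof -
    have "f differentiable (at x)" using Suc.prems(2) that by simp
    then show ?thesis using tr[OF that] unfolding differentiable_def by blast
  qed
  moreover have "Ck_on k (\<lambda>x. frechet_derivative g (at x) v) S" for v
  proof (rule Suc.IH)
    show "Ck_on k (\<lambda>x. frechet_derivative f (at x) v) S" using Suc.prems(2) by simp
    show "frechet_derivative f (at x) v = frechet_derivative g (at x) v" if "x \<in> S" for x
      using tr[OF that] Suc.prems(2) that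
      by (metis Ck_on.simps(2) frechet_derivative_at frechet_derivative_works)
  qed
  ultimately show ?case by simp
qed

text \<open>Lets the derivative be given by a formula instead of the chosen
  \<open>frechet_derivative\<close> of the definition. The two agree on \<open>S\<close>, and
  openness of \<open>S\<close> passes this on to their derivatives.\<close>

lemma Ck_on_SucI:
  assumes "open S" "\<And>x. x \<in> S \<Longrightarrow> (f has_derivative f' x) (at x)" "\<And>v. Ck_on k (\<lambda>x. f' x v) S"
  shows "Ck_on (Suc k) f S"
proof -
  have "f' x v = frechet_derivative f (at x) v" if "x \<in> S" for x v
    using assms(2)[OF that] frechet_derivative_at by metis
  then have "Ck_on k (\<lambda>x. frechet_derivative f (at x) v) S" for v
    by (rule Ck_on_cong[OF assms(1) _ assms(3)])
  with assms(2) show ?thesis by (auto intro: differentiableI)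
qed

lemma Ck_on_has_derivative:
  "Ck_on (Suc k) f S \<Longrightarrow> x \<in> S \<Longrightarrow> (f has_derivative frechet_derivative f (at x)) (at x)"
  using frechet_derivative_works by auto

lemma Ck_on_differentiable: "Ck_on k f S \<Longrightarrow> 0 < k \<Longrightarrow> x \<in> S \<Longrightarrow> f differentiable (at x)"
  by (cases k) auto

lemma Ck_on_continuous: "Ck_on k f S \<Longrightarrow> continuous_on S f"
  by (cases k) (auto intro!: continuous_at_imp_continuous_on differentiable_imp_continuous_within)

lemma Ck_on_lower: "Ck_on (Suc k) f S \<Longrightarrow> Ck_on k f S"
proof (induction k arbitrary: f)
  case 0
  from Ck_on_continuous[OF 0] show ?case by (simp only: Ck_on.simps(1))
next
  case (Suc k)
  have "\<forall>x\<in>S. f differentiable (at x)" "\<And>v. Ck_on (Suc k) (\<lambda>x. frechet_derivative f (at x) v) S"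
    using Suc.prems unfolding Ck_on.simps(2)[of "Suc k"] by blast+
  with Suc.IH show ?case unfolding Ck_on.simps(2)[of k] by blast
qed

lemma Ck_on_dir_deriv: "Ck_on (Suc k) f S \<Longrightarrow> Ck_on k (dir_deriv v f) S"
  by (simp add: dir_deriv_def[abs_def])

lemma Ck_on_pd: "Ck_on (Suc k) f S \<Longrightarrow> Ck_on k (pd i f) S"
  by (simp add: pd_def Ck_on_dir_deriv)

lemma Ck_on_const: "open S \<Longrightarrow> Ck_on k (\<lambda>x. a) S"
proof (induction k arbitrary: a)
  case (Suc k)
  show ?case by (rule Ck_on_SucI[where f' = "\<lambda>_ _. 0"]) (use Suc in auto)
qed simp

lemma Ck_on_bounded_linear: "open S \<Longrightarrow> bounded_linear f \<Longrightarrow> Ck_on k f S"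
proof (cases k)
  case (Suc k')
  assume *: "open S" "bounded_linear f"
  then show ?thesis unfolding Suc
    by (intro Ck_on_SucI[where f' = "\<lambda>_. f"] Ck_on_const bounded_linear_imp_has_derivative)
qed (simp add: linear_continuous_on)

lemma Ck_on_add:
  assumes "open S" "Ck_on k f S" "Ck_on k g S"
  shows "Ck_on k (\<lambda>x. f x + g x) S"
  using assms(2,3)
proof (induction k arbitrary: f g)
  case (Suc k)
  show ?case
  proof (rule Ck_on_SucI[OF assms(1)])
    show "((\<lambda>x. f x + g x) has_derivative
        (\<lambda>v. frechet_derivative f (at x) v + frechet_derivative g (at x) v)) (at x)" if "x \<in> S" for x
      using Suc.prems that by (intro has_derivative_add Ck_on_has_derivative)
    show "Ck_on k (\<lambda>x. frechet_derivative f (at x) v + frechet_derivative g (at x) v) S" for v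
      using Suc by simp
  qed
qed (simp add: continuous_on_add)

lemma Ck_on_scaleR:
  assumes "open S" "Ck_on k f S"
  shows "Ck_on k (\<lambda>x. c *\<^sub>R f x) S"
  using assms(2)
proof (induction k arbitrary: f)
  case (Suc k)
  show ?case
  proof (rule Ck_on_SucI[OF assms(1)])
    show "((\<lambda>x. c *\<^sub>R f x) has_derivative (\<lambda>v. c *\<^sub>R frechet_derivative f (at x) v)) (at x)"
      if "x \<in> S" for x
      using Suc.prems that by (intro has_derivative_scaleR_right Ck_on_has_derivative)
    show "Ck_on k (\<lambda>x. c *\<^sub>R frechet_derivative f (at x) v) S" for v
      using Suc by simp
  qed
qed (simp add: continuous_on_scaleR)

lemma Ck_on_cmult: "open S \<Longrightarrow> Ck_on k f S \<Longrightarrow> Ck_on k (\<lambda>x. c * f x :: real) S"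
  using Ck_on_scaleR[of S k f c] by simp

lemma Ck_on_sum:
  assumes "open S" "finite J" "\<And>j. j \<in> J \<Longrightarrow> Ck_on k (f j) S"
  shows "Ck_on k (\<lambda>x. \<Sum>j\<in>J. f j x) S"
  using assms(2,3) by (induction J rule: finite_induct) (auto intro: Ck_on_const Ck_on_add assms(1))

text \<open>For linear \<open>T\<close> the derivative of \<open>f o T\<close> in a direction
  \<open>v\<close> is again a C^k function, the derivative of \<open>f\<close> along the constant
  vector \<open>T v\<close>, composed with \<open>T\<close>. The induction thus closes without a
  product rule.\<close>

lemma Ck_on_compose_linear:
  assumes T: "bounded_linear T" and "open S" "Ck_on k f S"
  shows "Ck_on k (\<lambda>x. f (T x)) (T -` S)"
  using assms(3)
proof (induction k arbitrary: f)
  case 0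
  show ?case
    using continuous_on_compose2[of S f "T -` S" T] 0 linear_continuous_on[OF T] by auto
next
  case (Suc k)
  have op: "open (T -` S)"
    using T assms(2) by (intro open_vimage linear_continuous_on) auto
  show ?case
  proof (rule Ck_on_SucI[OF op])
    show "((\<lambda>x. f (T x)) has_derivative (\<lambda>v. frechet_derivative f (at (T x)) (T v))) (at x)"
      if "x \<in> T -` S" for x
      using has_derivative_compose[OF bounded_linear_imp_has_derivative[OF T] Ck_on_has_derivative[OF Suc.prems]]
        that by auto
    show "Ck_on k (\<lambda>x. frechet_derivative f (at (T x)) (T v)) (T -` S)" for v
      using Suc.IH[of "\<lambda>z. frechet_derivative f (at z) (T v)"] Suc.prems by auto
  qed
qed

section \<open>Symmetry of second derivatives\<close>

text \<open>The mean value theorem applied twice: the second difference is the increment along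
  \<open>u\<close> of the first difference \<open>?g\<close> along \<open>v\<close>; the derivative
  of \<open>?g\<close> is in turn an increment of \<open>dir_deriv u f\<close> along
  \<open>v\<close>.\<close>

lemma second_difference_mean_value:
  fixes f :: "'a::euclidean_space \<Rightarrow> real"
  assumes C2: "Ck_on 2 f S" and "0 < t"
    and S: "\<And>s r. 0 \<le> s \<Longrightarrow> s \<le> t \<Longrightarrow> 0 \<le> r \<Longrightarrow> r \<le> t \<Longrightarrow> x + s *\<^sub>R u + r *\<^sub>R v \<in> S"
  shows "\<exists>s r. 0 < s \<and> s < t \<and> 0 < r \<and> r < t \<and>
    f (x + t *\<^sub>R u + t *\<^sub>R v) - f (x + t *\<^sub>R u) - f (x + t *\<^sub>R v) + f x
      = t\<^sup>2 * dir_deriv v (dir_deriv u f) (x + s *\<^sub>R u + r *\<^sub>R v)"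
proof -
  have C2': "Ck_on (Suc (Suc 0)) f S" using C2 by (simp only: numeral_2_eq_2)
  have line: "((\<lambda>s. g (p + s *\<^sub>R w)) has_real_derivative dir_deriv w g (p + s *\<^sub>R w)) (at s)"
    if "g differentiable (at (p + s *\<^sub>R w))" for g :: "'a \<Rightarrow> real" and p w s
  proof -
    have 1: "((\<lambda>s. p + s *\<^sub>R w) has_vector_derivative w) (at s)"
      by (auto intro!: derivative_eq_intros)
    have 2: "(g has_derivative frechet_derivative g (at (p + s *\<^sub>R w))) (at (p + s *\<^sub>R w))"
      using that frechet_derivative_works by blast
    have "((g \<circ> (\<lambda>s. p + s *\<^sub>R w)) has_vector_derivative frechet_derivative g (at (p + s *\<^sub>R w)) w) (at s)"
      by (rule vector_derivative_diff_chain_within[OF 1 has_derivative_at_withinI[OF 2]])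
    then show ?thesis
      by (simp add: has_real_derivative_iff_has_vector_derivative dir_deriv_def o_def)
  qed
  have f_diff: "f differentiable (at z)" and Duf_diff: "dir_deriv u f differentiable (at z)" if "z \<in> S" for z
    using Ck_on_differentiable[OF C2' _ that] Ck_on_differentiable[OF Ck_on_dir_deriv[OF C2'] _ that]
    by simp_all
  let ?g = "\<lambda>s. f (x + t *\<^sub>R v + s *\<^sub>R u) - f (x + s *\<^sub>R u)"
  have "\<exists>s. 0 < s \<and> s < t \<and>
    ?g t - ?g 0 = (t - 0) * (dir_deriv u f (x + t *\<^sub>R v + s *\<^sub>R u) - dir_deriv u f (x + s *\<^sub>R u))"
  proof (rule MVT2[OF \<open>0 < t\<close>])
    fix s assume s: "0 \<le> s" "s \<le> t"
    have "x + t *\<^sub>R v + s *\<^sub>R u \<in> S" "x + s *\<^sub>R u \<in> S"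
      using S[OF s, of t] S[OF s, of 0] \<open>0 < t\<close> by (simp_all add: add.commute add.left_commute)
    then show "(?g has_real_derivative
        dir_deriv u f (x + t *\<^sub>R v + s *\<^sub>R u) - dir_deriv u f (x + s *\<^sub>R u)) (at s)"
      by (intro derivative_intros line f_diff)
  qed
  then obtain s where s: "0 < s" "s < t" and
    gs: "?g t - ?g 0 = t * (dir_deriv u f (x + t *\<^sub>R v + s *\<^sub>R u) - dir_deriv u f (x + s *\<^sub>R u))"
    by auto
  let ?h = "\<lambda>r. dir_deriv u f (x + s *\<^sub>R u + r *\<^sub>R v)"
  have "\<exists>r. 0 < r \<and> r < t \<and>
    ?h t - ?h 0 = (t - 0) * dir_deriv v (dir_deriv u f) (x + s *\<^sub>R u + r *\<^sub>R v)"
  proof (rule MVT2[OF \<open>0 < t\<close>])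
    fix r assume "0 \<le> r" "r \<le> t"
    then show "(?h has_real_derivative dir_deriv v (dir_deriv u f) (x + s *\<^sub>R u + r *\<^sub>R v)) (at r)"
      using s by (intro line Duf_diff S) simp_all
  qed
  then obtain r where "0 < r" "r < t" and
    "?h t - ?h 0 = t * dir_deriv v (dir_deriv u f) (x + s *\<^sub>R u + r *\<^sub>R v)"
    by auto
  moreover have swap: "x + t *\<^sub>R v + t *\<^sub>R u = x + t *\<^sub>R u + t *\<^sub>R v"
    "x + t *\<^sub>R v + s *\<^sub>R u = x + s *\<^sub>R u + t *\<^sub>R v" by simp_all
  moreover have "f (x + t *\<^sub>R u + t *\<^sub>R v) - f (x + t *\<^sub>R u) - f (x + t *\<^sub>R v) + f x
      = t * (dir_deriv u f (x + s *\<^sub>R u + t *\<^sub>R v) - dir_deriv u f (x + s *\<^sub>R u))"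
    using gs unfolding swap by simp
  ultimately have "f (x + t *\<^sub>R u + t *\<^sub>R v) - f (x + t *\<^sub>R u) - f (x + t *\<^sub>R v) + f x
      = t\<^sup>2 * dir_deriv v (dir_deriv u f) (x + s *\<^sub>R u + r *\<^sub>R v)"
    by (simp add: power2_eq_square)
  with s \<open>0 < r\<close> \<open>r < t\<close> show ?thesis by blast
qed

text \<open>The second difference is symmetric in \<open>u\<close> and \<open>v\<close>, so the two
  mixed derivatives take a common value at two points arbitrarily close to \<open>x\<close>. Their
  continuity then forces equality at \<open>x\<close>.\<close>

lemma dir_deriv_commute:
  fixes f :: "'a::euclidean_space \<Rightarrow> real"
  assumes C2: "Ck_on 2 f S" and S: "open S" "x \<in> S"
  shows "dir_deriv u (dir_deriv v f) x = dir_deriv v (dir_deriv u f) x"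
proof -
  let ?A = "dir_deriv u (dir_deriv v f)" and ?B = "dir_deriv v (dir_deriv u f)"
  have C2': "Ck_on (Suc (Suc 0)) f S" using C2 by (simp only: numeral_2_eq_2)
  have cont: "continuous_on S (dir_deriv w (dir_deriv w' f))" for w w'
    using Ck_on_continuous[OF Ck_on_dir_deriv[OF Ck_on_dir_deriv[OF C2']]] .
  have "\<bar>?A x - ?B x\<bar> \<le> e" if "0 < e" for e
  proof -
    have "\<forall>\<^sub>F z in nhds x. z \<in> S \<and> dist (?A z) (?A x) < e / 2 \<and> dist (?B z) (?B x) < e / 2"
    proof (intro eventually_conj)
      show "\<forall>\<^sub>F z in nhds x. z \<in> S" using S by (rule eventually_nhds_in_open)
      have "(?A \<longlongrightarrow> ?A x) (nhds x)" "(?B \<longlongrightarrow> ?B x) (nhds x)"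
        using cont S by (simp_all add: continuous_on_eq_continuous_at isCont_def tendsto_at_iff_tendsto_nhds)
      then show "\<forall>\<^sub>F z in nhds x. dist (?A z) (?A x) < e / 2" "\<forall>\<^sub>F z in nhds x. dist (?B z) (?B x) < e / 2"
        using half_gt_zero[OF \<open>0 < e\<close>] unfolding tendsto_iff by blast+
    qed
    then obtain d where "0 < d" and
      d: "\<And>z. dist z x < d \<Longrightarrow> z \<in> S \<and> dist (?A z) (?A x) < e / 2 \<and> dist (?B z) (?B x) < e / 2"
      unfolding eventually_nhds_metric by blast
    \<comment> \<open>With this \<open>t\<close> the whole parallelogram spanned by
      \<open>t u\<close> and \<open>t v\<close> stays within distance \<open>d\<close> of
      \<open>x\<close>; the summand 1 keeps the denominator positive when both directions
      vanish.\<close>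
    define t where "t = d / (norm u + norm v + 1)"
    have "0 < norm u + norm v + 1" by (simp add: add_nonneg_pos)
    then have t: "0 < t" "t * (norm u + norm v) < d"
      using \<open>0 < d\<close> by (auto simp: t_def field_simps add_pos_nonneg)
    have near: "dist (x + s *\<^sub>R u + r *\<^sub>R v) x < d" if "0 \<le> s" "s \<le> t" "0 \<le> r" "r \<le> t" for s r
    proof -
      have "norm (s *\<^sub>R u + r *\<^sub>R v) \<le> s * norm u + r * norm v"
        using norm_triangle_ineq[of "s *\<^sub>R u" "r *\<^sub>R v"] that by simp
      also have "\<dots> \<le> t * norm u + t * norm v"
        using that by (intro add_mono mult_right_mono) auto
      finally show ?thesis using t by (simp add: dist_norm algebra_simps)
    qed
    then have near': "dist (x + s *\<^sub>R v + r *\<^sub>R u) x < d" if "0 \<le> s" "s \<le> t" "0 \<le> r" "r \<le> t" for s r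
      using near[of r s] that by (simp add: add.commute add.left_commute)
    let ?\<Delta> = "f (x + t *\<^sub>R u + t *\<^sub>R v) - f (x + t *\<^sub>R u) - f (x + t *\<^sub>R v) + f x"
    have "\<exists>s r. 0 < s \<and> s < t \<and> 0 < r \<and> r < t \<and>
        f (x + t *\<^sub>R u + t *\<^sub>R v) - f (x + t *\<^sub>R u) - f (x + t *\<^sub>R v) + f x
          = t\<^sup>2 * ?B (x + s *\<^sub>R u + r *\<^sub>R v)"
      by (rule second_difference_mean_value[OF C2 t(1)]) (use near d in blast)
    then obtain s r where sr: "0 < s" "s < t" "0 < r" "r < t" and
      B: "?\<Delta> = t\<^sup>2 * ?B (x + s *\<^sub>R u + r *\<^sub>R v)" by blast
    have "\<exists>s r. 0 < s \<and> s < t \<and> 0 < r \<and> r < t \<and>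
        f (x + t *\<^sub>R v + t *\<^sub>R u) - f (x + t *\<^sub>R v) - f (x + t *\<^sub>R u) + f x
          = t\<^sup>2 * ?A (x + s *\<^sub>R v + r *\<^sub>R u)"
      by (rule second_difference_mean_value[OF C2 t(1)]) (use near' d in blast)
    then obtain s' r' where sr': "0 < s'" "s' < t" "0 < r'" "r' < t" and
      A: "f (x + t *\<^sub>R v + t *\<^sub>R u) - f (x + t *\<^sub>R v) - f (x + t *\<^sub>R u) + f x
          = t\<^sup>2 * ?A (x + s' *\<^sub>R v + r' *\<^sub>R u)" by blast
    have swap: "x + t *\<^sub>R v + t *\<^sub>R u = x + t *\<^sub>R u + t *\<^sub>R v" by simp
    have "?\<Delta> = t\<^sup>2 * ?A (x + s' *\<^sub>R v + r' *\<^sub>R u)" using A unfolding swap by linarith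
    with B t(1) have "?A (x + s' *\<^sub>R v + r' *\<^sub>R u) = ?B (x + s *\<^sub>R u + r *\<^sub>R v)" by simp
    moreover have "dist (x + s *\<^sub>R u + r *\<^sub>R v) x < d" "dist (x + s' *\<^sub>R v + r' *\<^sub>R u) x < d"
      using sr sr' by (simp_all add: near near' del: dist_add_cancel)
    ultimately show ?thesis using d unfolding dist_real_def by (smt (verit, best) field_sum_of_halves)
  qed
  then have "\<bar>?A x - ?B x\<bar> \<le> 0" by (metis add_0 field_le_epsilon)
  then show ?thesis by simp
qed

lemma pd_commute: "Ck_on 2 f S \<Longrightarrow> open S \<Longrightarrow> x \<in> S \<Longrightarrow> pd i (pd j f) x = pd j (pd i f) x"
  unfolding pd_def by (rule dir_deriv_commute)


section \<open>Matrices depending on a parameter\<close>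

lemma matrix_inv:
  fixes A :: "real^'n::finite^'n"
  assumes "invertible A"
  shows "A ** matrix_inv A = mat 1" and "matrix_inv A ** A = mat 1"
  using someI_ex[OF assms[unfolded invertible_def]] by (auto simp: matrix_inv_def)

lemma matrix_inv_eqI:
  fixes A :: "real^'n::finite^'n"
  assumes "A ** A' = mat 1"
  shows "matrix_inv A = A'"
proof -
  have "invertible A" using assms invertible_right_inverse by blast
  then show ?thesis
    by (metis assms matrix_inv(2) matrix_mul_assoc matrix_mul_lid matrix_mul_rid)
qed

lemma matrix_mult_eq_1_nth:
  fixes A A' :: "real^'n::finite^'n"
  assumes "A ** A' = mat 1"
  shows "(\<Sum>k\<in>UNIV. A $ i $ k * A' $ k $ j) = (if i = j then 1 else 0)"
  using arg_cong[OF assms, of "\<lambda>M. M $ i $ j"] by (simp add: matrix_matrix_mult_def mat_def)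

lemma matrix_inv_nth:
  fixes A :: "real^'n::finite^'n"
  assumes "invertible A"
  shows "(\<Sum>k\<in>UNIV. A $ i $ k * matrix_inv A $ k $ j) = (if i = j then 1 else 0)"
    and "(\<Sum>k\<in>UNIV. matrix_inv A $ i $ k * A $ k $ j) = (if i = j then 1 else 0)"
  by (rule matrix_mult_eq_1_nth, rule matrix_inv[OF assms])+

section \<open>Differentiating an inverse matrix\<close>

lemma differentiable_prod:
  fixes f :: "'i \<Rightarrow> 'a::real_normed_vector \<Rightarrow> real"
  assumes "\<And>i. i \<in> I \<Longrightarrow> f i differentiable (at x)"
  shows "(\<lambda>z. \<Prod>i\<in>I. f i z) differentiable (at x)"
proof -
  from assms have "\<forall>i\<in>I. \<exists>f'. (f i has_derivative f') (at x)"
    by (simp add: differentiable_def)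
  then obtain f' where "\<And>i. i \<in> I \<Longrightarrow> (f i has_derivative f' i) (at x)" by metis
  then have "((\<lambda>z. \<Prod>i\<in>I. f i z) has_derivative (\<lambda>y. \<Sum>i\<in>I. f' i y * (\<Prod>j\<in>I - {i}. f j x))) (at x)"
    by (rule has_derivative_prod)
  then show ?thesis by (rule differentiableI)
qed

lemma differentiable_det:
  fixes A :: "'a::real_normed_vector \<Rightarrow> real^'n::finite^'n"
  assumes "\<And>i j. (\<lambda>z. A z $ i $ j) differentiable (at x)"
  shows "(\<lambda>z. det (A z)) differentiable (at x)"
  unfolding det_def
  by (auto intro!: differentiable_sum differentiable_mult differentiable_prod assms finite_permutations)

text \<open>By Cramer's rule an entry of the inverse is a quotient of determinants, and determinants
  are polynomials in the entries. In \<open>?C\<close> the column \<open>i\<close> is replaced by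
  the unit vector \<open>j\<close>.\<close>

lemma differentiable_matrix_inv:
  fixes A :: "'a::real_normed_vector \<Rightarrow> real^'n::finite^'n"
  assumes "open S" "x \<in> S" "\<And>z. z \<in> S \<Longrightarrow> invertible (A z)"
    and "\<And>i j. (\<lambda>z. A z $ i $ j) differentiable (at x)"
  shows "(\<lambda>z. matrix_inv (A z) $ i $ j) differentiable (at x)"
proof -
  let ?C = "\<lambda>z. (\<chi> p q. if q = i then (axis j 1 :: real^'n) $ p else A z $ p $ q) :: real^'n^'n"
  have *: "matrix_inv (A z) $ i $ j = det (?C z) / det (A z)" if "z \<in> S" for z
  proof -
    have inv: "invertible (A z)" using assms(3) that .
    have "A z *v (matrix_inv (A z) *v axis j 1) = axis j 1"
      by (simp add: matrix_vector_mul_assoc matrix_inv[OF inv])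
    then have "matrix_inv (A z) *v axis j 1 =
        (\<chi> k. det (\<chi> p q. if q = k then (axis j 1 :: real^'n) $ p else A z $ p $ q) / det (A z))"
      using cramer inv invertible_det_nz by blast
    from arg_cong[OF this, of "\<lambda>v. v $ i"] show ?thesis
      by (simp add: matrix_vector_mult_basis column_def)
  qed
  have "(\<lambda>z. ?C z $ p $ q) differentiable (at x)" for p q
    using assms(4) by (cases "q = i") auto
  then have "(\<lambda>z. det (?C z) / det (A z)) differentiable (at x)"
    using assms invertible_det_nz
    by (intro differentiable_divide differentiable_det) blast+
  then show ?thesis
    using * assms(1,2) unfolding differentiable_def
    by (metis (no_types, lifting) has_derivative_transform_within_open)
qed

text \<open>Differentiate \<open>A A^{-1} = 1\<close> entrywise by the product rule and multiply by
  the inverse from the left.\<close>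

lemma pd_matrix_inv:
  fixes A :: "real^'k::finite \<Rightarrow> real^'n::finite^'n"
  assumes S: "open S" "x \<in> S" and inv: "\<And>z. z \<in> S \<Longrightarrow> invertible (A z)"
    and diff: "\<And>i j. (\<lambda>z. A z $ i $ j) differentiable (at x)"
  shows "pd s (\<lambda>z. matrix_inv (A z) $ i $ j) x =
    - (\<Sum>p\<in>UNIV. \<Sum>q\<in>UNIV. matrix_inv (A x) $ i $ p * pd s (\<lambda>z. A z $ p $ q) x * matrix_inv (A x) $ q $ j)"
proof -
  let ?V = "\<lambda>z. matrix_inv (A z)"
  let ?dV = "\<lambda>i j. pd s (\<lambda>z. ?V z $ i $ j) x" and ?dA = "\<lambda>i j. pd s (\<lambda>z. A z $ i $ j) x"
  have dV: "(\<lambda>z. ?V z $ i $ j) differentiable (at x)" for i j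
    using differentiable_matrix_inv[OF S inv diff] .
  have "(\<Sum>q\<in>UNIV. A x $ p $ q * ?dV q j + ?dA p q * ?V x $ q $ j) = 0" for p
  proof -
    have "(\<Sum>q\<in>UNIV. A x $ p $ q * ?dV q j + ?dA p q * ?V x $ q $ j)
        = pd s (\<lambda>z. \<Sum>q\<in>UNIV. A z $ p $ q * ?V z $ q $ j) x"
      by (simp add: pd_sum pd_mult diff dV)
    also have "\<dots> = pd s (\<lambda>z. if p = j then 1 else 0) x"
      by (rule pd_cong[OF S]) (simp add: matrix_inv_nth inv)
    also have "\<dots> = 0" by (subst pd_eq[OF has_derivative_const]) simp
    finally show ?thesis .
  qed
  then have "0 = (\<Sum>p\<in>UNIV. ?V x $ i $ p * (\<Sum>q\<in>UNIV. A x $ p $ q * ?dV q j + ?dA p q * ?V x $ q $ j))"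
    by simp
  also have "\<dots> = (\<Sum>p\<in>UNIV. \<Sum>q\<in>UNIV. ?V x $ i $ p * A x $ p $ q * ?dV q j)
      + (\<Sum>p\<in>UNIV. \<Sum>q\<in>UNIV. ?V x $ i $ p * ?dA p q * ?V x $ q $ j)"
    by (simp add: sum.distrib sum_distrib_left algebra_simps)
  also have "(\<Sum>p\<in>UNIV. \<Sum>q\<in>UNIV. ?V x $ i $ p * A x $ p $ q * ?dV q j)
      = (\<Sum>q\<in>UNIV. (\<Sum>p\<in>UNIV. ?V x $ i $ p * A x $ p $ q) * ?dV q j)"
    by (subst sum.swap) (simp add: sum_distrib_right)
  also have "\<dots> = ?dV i j"
    by (simp add: matrix_inv_nth inv S if_distrib[of "\<lambda>t. t * _"] cong: if_cong)
  finally show ?thesis by linarith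
qed

section \<open>Third derivatives under a linear change of variables\<close>

text \<open>As \<open>y = B z\<close> is linear with constant \<open>B\<close>, the chain rule
  produces no derivatives of \<open>B\<close>: each lower index only acquires a factor
  \<open>B\<close>, which meets a factor \<open>E\<close> and cancels, and the upper index cancels
  the other way round.\<close>

lemma third_derivatives_tensorial:
  fixes f :: "'m::finite \<Rightarrow> real^'m \<Rightarrow> real" and B E :: "real^'m^'m"
  assumes W: "open W" "B *v z \<in> W" and f: "\<And>r. Ck_on 3 (f r) W"
    and BE: "B ** E = mat 1"
  shows "(\<Sum>\<rho>\<in>UNIV. \<Sum>\<alpha>\<in>UNIV. \<Sum>\<beta>\<in>UNIV. \<Sum>\<gamma>\<in>UNIV.
      pd \<alpha> (pd \<beta> (pd \<gamma> (\<lambda>z. \<Sum>r\<in>UNIV. E $ \<rho> $ r * f r (B *v z)))) z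
        * B $ r $ \<rho> * E $ \<alpha> $ a * E $ \<beta> $ b * E $ \<gamma> $ c)
    = pd a (pd b (pd c (f r))) (B *v z)"
proof -
  let ?W = "{z. B *v z \<in> W}"
  have op: "open ?W"
    using open_vimage[OF W(1), of "\<lambda>z. B *v z"] by (simp add: vimage_def linear_continuous_on)
  have step: "pd i (\<lambda>z. g (B *v z)) z = (\<Sum>a\<in>UNIV. B $ a $ i * pd a g (B *v z))"
    if "Ck_on (Suc k) g W" "z \<in> ?W" for g i z k
    using that by (intro pd_compose_linear Ck_on_differentiable[OF that(1)]) auto
  have f3: "Ck_on (Suc (Suc (Suc 0))) (f r) W" for r using f[of r] by (simp only: numeral_3_eq_3)
  \<comment> \<open>Collecting the sum over \<open>r\<close> first leaves one scalar function per
    \<rho> to be differentiated through \<open>B\<close>; the sum is reopened only in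
    \<open>h_der\<close>.\<close>
  define h where "h \<rho> y = (\<Sum>r\<in>UNIV. E $ \<rho> $ r * f r y)" for \<rho> y
  have h3: "Ck_on (Suc (Suc (Suc 0))) (h \<rho>) W" for \<rho>
    unfolding h_def by (intro Ck_on_sum Ck_on_cmult f3 W) simp
  have h2: "Ck_on (Suc (Suc 0)) (pd c (h \<rho>)) W" for c \<rho> by (rule Ck_on_pd[OF h3])
  have h1: "Ck_on (Suc 0) (pd b (pd c (h \<rho>))) W" for b c \<rho> by (rule Ck_on_pd[OF h2])
  have sum_step: "pd i (\<lambda>z. \<Sum>a\<in>UNIV. k a * g a (B *v z)) z
      = (\<Sum>a\<in>UNIV. k a * (\<Sum>b\<in>UNIV. B $ b $ i * pd b (g a) (B *v z)))"
    if g: "\<And>a. Ck_on (Suc n) (g a) W" and z: "z \<in> ?W" for g :: "'m \<Rightarrow> real^'m \<Rightarrow> real" and i z k n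
  proof -
    have "Ck_on (Suc n) (\<lambda>z. g a (B *v z)) ?W" for a
      using Ck_on_compose_linear[OF _ W(1) g[of a], of "\<lambda>z. B *v z"] by (simp add: vimage_def)
    then have d: "(\<lambda>z. g a (B *v z)) differentiable (at z)" for a
      using Ck_on_differentiable[OF _ _ z] by blast
    show ?thesis
      by (simp add: pd_sum pd_cmult d step[OF g z])
  qed
  have D1: "pd \<gamma> (\<lambda>z. h \<rho> (B *v z)) z = (\<Sum>c\<in>UNIV. B $ c $ \<gamma> * pd c (h \<rho>) (B *v z))"
    if "z \<in> ?W" for \<gamma> \<rho> z by (rule step[OF h3 that])
  have D2: "pd \<beta> (pd \<gamma> (\<lambda>z. h \<rho> (B *v z))) z
      = (\<Sum>c\<in>UNIV. B $ c $ \<gamma> * (\<Sum>b\<in>UNIV. B $ b $ \<beta> * pd b (pd c (h \<rho>)) (B *v z)))"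
    if "z \<in> ?W" for \<beta> \<gamma> \<rho> z
    by (subst pd_cong[OF op that D1], assumption) (rule sum_step[OF h2 that])
  have D3: "pd \<alpha> (pd \<beta> (pd \<gamma> (\<lambda>z. h \<rho> (B *v z)))) z = (\<Sum>c\<in>UNIV. B $ c $ \<gamma> *
      (\<Sum>b\<in>UNIV. B $ b $ \<beta> * (\<Sum>a\<in>UNIV. B $ a $ \<alpha> * pd a (pd b (pd c (h \<rho>))) (B *v z))))"
    if z: "z \<in> ?W" for \<alpha> \<beta> \<gamma> \<rho> z
  proof -
    have d: "pd b (pd c (h \<rho>)) differentiable (at (B *v z))" for b c
      using z by (intro Ck_on_differentiable[OF h1]) auto
    have lin: "((\<lambda>z. B *v z) has_derivative (\<lambda>z. B *v z)) (at z)"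
      by (rule linear_imp_has_derivative) simp
    have d': "(\<lambda>z. pd b (pd c (h \<rho>)) (B *v z)) differentiable (at z)" for b c
      using has_derivative_compose[OF lin has_derivative_pd[OF d]] differentiableI by blast
    have "pd \<alpha> (pd \<beta> (pd \<gamma> (\<lambda>z. h \<rho> (B *v z)))) z = pd \<alpha> (\<lambda>z.
        \<Sum>c\<in>UNIV. B $ c $ \<gamma> * (\<Sum>b\<in>UNIV. B $ b $ \<beta> * pd b (pd c (h \<rho>)) (B *v z))) z"
      by (rule pd_cong[OF op z D2])
    then show ?thesis
      by (simp add: pd_sum pd_cmult d' pd_compose_linear[OF d])
  qed
  \<comment> \<open>Cancels one pair \<open>B\<close>, \<open>E\<close>; the spectator
    \<open>k\<close> holds the factors whose turn comes later. It is applied once for each of the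
    three lower indices.\<close>
  have contract: "(\<Sum>i\<in>UNIV. (\<Sum>j\<in>UNIV. B $ j $ i * Z j) * k * E $ i $ a) = Z a * k"
    for Z :: "'m \<Rightarrow> real" and k a
  proof -
    have "(\<Sum>i\<in>UNIV. (\<Sum>j\<in>UNIV. B $ j $ i * Z j) * k * E $ i $ a)
        = (\<Sum>j\<in>UNIV. (\<Sum>i\<in>UNIV. B $ j $ i * E $ i $ a) * (Z j * k))"
      by (simp add: sum_distrib_left sum_distrib_right mult_ac)
        (rule sum.swap)
    then show ?thesis by (simp add: matrix_mult_eq_1_nth[OF BE] if_distrib[of "\<lambda>t. t * _"] cong: if_cong)
  qed
  have "pd c (h \<rho>) y = (\<Sum>r\<in>UNIV. E $ \<rho> $ r * pd c (f r) y)" if "y \<in> W" for c \<rho> y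
    unfolding h_def using that
    by (simp add: pd_sum pd_cmult Ck_on_differentiable[OF f3])
  then have "pd b (pd c (h \<rho>)) y = (\<Sum>r\<in>UNIV. E $ \<rho> $ r * pd b (pd c (f r)) y)" if "y \<in> W" for b c \<rho> y
    using that
    by (subst pd_cong[OF W(1) that]) (auto simp: pd_sum pd_cmult Ck_on_differentiable[OF Ck_on_pd[OF f3]])
  then have h_der: "pd a (pd b (pd c (h \<rho>))) y = (\<Sum>r\<in>UNIV. E $ \<rho> $ r * pd a (pd b (pd c (f r))) y)"
    if "y \<in> W" for a b c \<rho> y
    using that
    by (subst pd_cong[OF W(1) that])
       (auto simp: pd_sum pd_cmult Ck_on_differentiable[OF Ck_on_pd[OF Ck_on_pd[OF f3]]])
  let ?X = "\<lambda>\<rho> a b c. pd a (pd b (pd c (h \<rho>))) (B *v z)"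
  have "(\<Sum>\<rho>\<in>UNIV. \<Sum>\<alpha>\<in>UNIV. \<Sum>\<beta>\<in>UNIV. \<Sum>\<gamma>\<in>UNIV.
      pd \<alpha> (pd \<beta> (pd \<gamma> (\<lambda>z. h \<rho> (B *v z)))) z * B $ r $ \<rho> * E $ \<alpha> $ a * E $ \<beta> $ b * E $ \<gamma> $ c)
    = (\<Sum>\<rho>\<in>UNIV. \<Sum>\<alpha>\<in>UNIV. \<Sum>\<beta>\<in>UNIV. \<Sum>\<gamma>\<in>UNIV.
      (\<Sum>c\<in>UNIV. B $ c $ \<gamma> * (\<Sum>b\<in>UNIV. B $ b $ \<beta> * (\<Sum>a\<in>UNIV. B $ a $ \<alpha> * ?X \<rho> a b c)))
       * (B $ r $ \<rho> * E $ \<alpha> $ a * E $ \<beta> $ b) * E $ \<gamma> $ c)"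
    using W(2) by (simp only: D3 mem_Collect_eq mult.assoc)
  also have "\<dots> = (\<Sum>\<rho>\<in>UNIV. \<Sum>\<alpha>\<in>UNIV. \<Sum>\<beta>\<in>UNIV.
      (\<Sum>b\<in>UNIV. B $ b $ \<beta> * (\<Sum>a\<in>UNIV. B $ a $ \<alpha> * ?X \<rho> a b c)) * (B $ r $ \<rho> * E $ \<alpha> $ a) * E $ \<beta> $ b)"
    by (intro sum.cong refl, subst contract, simp only: mult.assoc)
  also have "\<dots> = (\<Sum>\<rho>\<in>UNIV. \<Sum>\<alpha>\<in>UNIV. (\<Sum>a\<in>UNIV. B $ a $ \<alpha> * ?X \<rho> a b c) * B $ r $ \<rho> * E $ \<alpha> $ a)"
    by (intro sum.cong refl, subst contract, simp only: mult.assoc)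
  also have "\<dots> = (\<Sum>\<rho>\<in>UNIV. (\<Sum>r\<in>UNIV. E $ \<rho> $ r * pd a (pd b (pd c (f r))) (B *v z)) * B $ r $ \<rho>)"
    by (simp only: contract h_der[OF W(2)])
  also have "\<dots> = (\<Sum>s\<in>UNIV. (\<Sum>\<rho>\<in>UNIV. B $ r $ \<rho> * E $ \<rho> $ s) * pd a (pd b (pd c (f s))) (B *v z))"
    by (simp add: sum_distrib_left sum_distrib_right mult_ac) (rule sum.swap)
  also have "\<dots> = pd a (pd b (pd c (f r))) (B *v z)"
    by (simp add: matrix_mult_eq_1_nth[OF BE] if_distrib[of "\<lambda>t. t * _"] cong: if_cong)
  finally show ?thesis by (simp only: h_def)
qed


section \<open>The frame components of the spray\<close>

lemma Ck_on_4_D: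
  assumes "Ck_on 4 f S"
  shows "Ck_on (Suc 0) f S" "Ck_on 2 f S" "Ck_on (Suc 0) (pd i f) S" "Ck_on 2 (pd i f) S"
    "Ck_on (Suc 0) (pd i (pd j f)) S"
proof -
  have f4: "Ck_on (Suc (Suc (Suc (Suc 0)))) f S"
    using assms by (simp add: numeral_eq_Suc del: Ck_on.simps)
  note f3 = Ck_on_lower[OF f4] and f2 = Ck_on_lower[OF Ck_on_lower[OF f4]]
  show "Ck_on 2 f S" "Ck_on 2 (pd i f) S" unfolding numeral_2_eq_2 by (rule f2, rule Ck_on_pd[OF f3])
  show "Ck_on (Suc 0) f S" "Ck_on (Suc 0) (pd i f) S" "Ck_on (Suc 0) (pd i (pd j f)) S"
    by (rule Ck_on_lower[OF f2], rule Ck_on_pd[OF f2], rule Ck_on_pd[OF Ck_on_pd[OF f3]])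
qed

text \<open>The part of the argument that takes place in a single fibre: \<open>L\<close> is a
  function of the components \<open>(y^a)\<close>, \<open>W\<close> is the cone in these components,
  and the base point does not occur.\<close>

locale frame_lagrangian =
  fixes L :: "real^'m::finite \<Rightarrow> real" and W :: "(real^'m) set"
  assumes open_W: "open W" and L_C4: "Ck_on 4 L W"
    and nondegenerate: "\<And>y. y \<in> W \<Longrightarrow> invertible (metric L y)"
begin

lemma metric_nth: "metric L y $ a $ b = pd a (pd b L) y"
  by (simp add: metric_def)

lemma L_diff: "y \<in> W \<Longrightarrow> L differentiable (at y)"
  and dL_diff: "y \<in> W \<Longrightarrow> pd a L differentiable (at y)"
  and ddL_diff: "y \<in> W \<Longrightarrow> pd a (pd b L) differentiable (at y)"
  using Ck_on_4_D[OF L_C4] by (blast intro: Ck_on_differentiable)+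

lemma metric_sym: "y \<in> W \<Longrightarrow> pd a (pd b L) y = pd b (pd a L) y"
  using pd_commute[OF Ck_on_4_D(2)[OF L_C4] open_W] .

lemma metric_inv_sym:
  assumes "y \<in> W"
  shows "metric_inv L y $ a $ b = metric_inv L y $ b $ a"
proof -
  let ?g = "metric L y"
  have "transpose ?g = ?g"
    using metric_sym[OF assms] by (simp add: transpose_def metric_def vec_eq_iff)
  then have "?g ** transpose (matrix_inv ?g) = mat 1"
    using arg_cong[OF matrix_inv(2)[OF nondegenerate[OF assms]], of transpose]
    by (simp add: matrix_transpose_mul)
  then have "matrix_inv ?g = transpose (matrix_inv ?g)" by (rule matrix_inv_eqI)
  from arg_cong[OF this, of "\<lambda>M. M $ a $ b"] show ?thesis
    by (simp add: metric_inv_def transpose_def)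
qed

lemma metric_inv_metric:
  assumes "y \<in> W"
  shows "(\<Sum>p\<in>UNIV. metric_inv L y $ r $ p * pd p (pd b L) y) = (if r = b then 1 else 0)"
  using matrix_inv_nth(2)[OF nondegenerate[OF assms], of r b]
  by (simp add: metric_inv_def metric_nth)

lemma metric_inv_diff: "y \<in> W \<Longrightarrow> (\<lambda>y. metric_inv L y $ a $ b) differentiable (at y)"
  unfolding metric_inv_def
  by (rule differentiable_matrix_inv[OF open_W]) (simp_all add: nondegenerate metric_nth ddL_diff)

text \<open>The derivative of the inverse gives \<open>- g^{sb} (d_s g_{bc}) g^{cp}\<close>. By
  total symmetry of the third derivatives the contracted indices can be moved to
  \<open>g^{sb} d_c g_{sb}\<close>, which is \<open>2 I_c\<close> because \<open>C\<close> carries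
  the factor 1/2.\<close>

lemma divergence_metric_inv:
  assumes y: "y \<in> W"
  shows "(\<Sum>s\<in>UNIV. pd s (\<lambda>y. metric_inv L y $ s $ p) y) = - 2 * mean_cartan_up L p y"
proof -
  let ?i = "\<lambda>a b. metric_inv L y $ a $ b"
  \<comment> \<open>Two exchanges are needed: symmetry of the Hessian under the outer derivative,
    and then commuting the outer derivatives of \<open>pd b L\<close>, which must itself be
    C^2.\<close>
  have sym3: "pd s (pd b (pd c L)) y = pd c (pd s (pd b L)) y" for s b c
  proof -
    have "pd s (pd b (pd c L)) y = pd s (pd c (pd b L)) y"
      by (rule pd_cong[OF open_W y metric_sym])
    also have "\<dots> = pd c (pd s (pd b L)) y"
      by (rule pd_commute[OF Ck_on_4_D(4)[OF L_C4] open_W y])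
    finally show ?thesis .
  qed
  have "pd s (\<lambda>y. metric_inv L y $ s $ p) y
      = - (\<Sum>b\<in>UNIV. \<Sum>c\<in>UNIV. ?i s b * pd s (pd b (pd c L)) y * ?i c p)" for s
    unfolding metric_inv_def
    by (subst pd_matrix_inv[OF open_W y]) (simp_all add: nondegenerate metric_nth ddL_diff y)
  also have "\<dots> s = - (\<Sum>c\<in>UNIV. \<Sum>b\<in>UNIV. ?i p c * (?i s b * pd c (pd s (pd b L)) y))" for s
    by (subst sum.swap) (simp add: sym3 metric_inv_sym[OF y, of _ p] mult_ac)
  finally have "(\<Sum>s\<in>UNIV. pd s (\<lambda>y. metric_inv L y $ s $ p) y)
      = - (\<Sum>s\<in>UNIV. \<Sum>c\<in>UNIV. \<Sum>b\<in>UNIV. ?i p c * (?i s b * pd c (pd s (pd b L)) y))"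
    by (simp add: sum_negf)
  also have "\<dots> = - (\<Sum>c\<in>UNIV. \<Sum>s\<in>UNIV. \<Sum>b\<in>UNIV. ?i p c * (?i s b * pd c (pd s (pd b L)) y))"
    by (subst sum.swap) simp
  also have "\<dots> = - 2 * mean_cartan_up L p y"
    by (simp add: mean_cartan_up_def mean_cartan_def cartan_def sum_distrib_left sum_negf mult_ac)
  finally show ?thesis .
qed

text \<open>The spray in the frame is \<open>\<Sum>\<^sub>r e\<^sub>r * frame_spray cc K r\<close>, where the coefficients \<open>K\<close> stem from the
  derivatives of the coframe.\<close>

definition frame_spray :: "('m \<Rightarrow> 'm \<Rightarrow> 'm \<Rightarrow> real) \<Rightarrow> ('m \<Rightarrow> 'm \<Rightarrow> 'm \<Rightarrow> real) \<Rightarrow> 'm \<Rightarrow> real^'m \<Rightarrow> real" where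
  "frame_spray cc K r y =
    (\<Sum>e\<in>UNIV. \<Sum>p\<in>UNIV. \<Sum>q\<in>UNIV. (1/2 * cc e p q) * (metric_inv L y $ r $ p * pd e L y * y $ q))
    + (\<Sum>p\<in>UNIV. \<Sum>q\<in>UNIV. K r p q * (y $ p * y $ q))"

lemma frame_spray_diff: "y \<in> W \<Longrightarrow> frame_spray cc K r differentiable (at y)"
  unfolding frame_spray_def[abs_def]
  by (intro differentiable_add differentiable_sum differentiable_mult differentiable_const
      metric_inv_diff dL_diff differentiable_nth ballI) auto

lemma pd_frame_spray:
  assumes y: "y \<in> W"
  shows "pd s (frame_spray cc K r) y =
    (\<Sum>e\<in>UNIV. \<Sum>p\<in>UNIV. \<Sum>q\<in>UNIV. (1/2 * cc e p q) *
        (metric_inv L y $ r $ p * pd e L y * (if s = q then 1 else 0)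
         + (metric_inv L y $ r $ p * pd s (pd e L) y + pd s (\<lambda>y. metric_inv L y $ r $ p) y * pd e L y) * y $ q))
    + (\<Sum>p\<in>UNIV. \<Sum>q\<in>UNIV. K r p q * (y $ p * (if s = q then 1 else 0) + (if s = p then 1 else 0) * y $ q))"
  unfolding frame_spray_def[abs_def]
  by (simp add: pd_add pd_sum pd_cmult pd_mult pd_nth metric_inv_diff[OF y] dL_diff[OF y] del: times_divide_eq_left)

text \<open>The product rule has three terms. Differentiating \<open>y^q\<close> contracts the
  symmetric \<open>g^{qp}\<close> with the antisymmetric \<open>c\<close> and gives 0.
  Differentiating \<open>y_e\<close> gives \<open>g_{se}\<close>, which \<open>g^{sp}\<close> turns
  into a Kronecker delta, leaving the linear form \<open>1/2 c^p_{pq} y^q\<close>. Only the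
  derivative of \<open>g^{sp}\<close> contributes the mean Cartan tensor; the factors 1/2 and -2
  combine to -1.\<close>

lemma divergence_frame_spray:
  assumes y: "y \<in> W" and antisym: "\<And>e p q. cc e p q = - cc e q p"
  shows "(\<Sum>s\<in>UNIV. pd s (frame_spray cc K s) y) =
    - (\<Sum>e\<in>UNIV. \<Sum>p\<in>UNIV. \<Sum>q\<in>UNIV. cc e p q * (mean_cartan_up L p y * pd e L y * y $ q))
    + (\<Sum>q\<in>UNIV. ((\<Sum>p\<in>UNIV. 1/2 * cc p p q) + (\<Sum>s\<in>UNIV. K s q s + K s s q)) * y $ q)"
proof -
  let ?i = "\<lambda>a b. metric_inv L y $ a $ b" and ?c = "\<lambda>e p q. 1/2 * cc e p q"
  let ?di = "\<lambda>s p. pd s (\<lambda>y. metric_inv L y $ s $ p) y"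
  have swap: "(\<Sum>s\<in>UNIV. \<Sum>e\<in>UNIV. \<Sum>p\<in>UNIV. \<Sum>q\<in>UNIV. X s e p q)
      = (\<Sum>e\<in>UNIV. \<Sum>p\<in>UNIV. \<Sum>q\<in>UNIV. \<Sum>s\<in>UNIV. X s e p q)" for X :: "'m \<Rightarrow> 'm \<Rightarrow> 'm \<Rightarrow> 'm \<Rightarrow> real"
  proof -
    have "(\<Sum>s\<in>UNIV. \<Sum>e\<in>UNIV. \<Sum>p\<in>UNIV. \<Sum>q\<in>UNIV. X s e p q)
      = (\<Sum>e\<in>UNIV. \<Sum>s\<in>UNIV. \<Sum>p\<in>UNIV. \<Sum>q\<in>UNIV. X s e p q)" by (rule sum.swap)
    also have "\<dots> = (\<Sum>e\<in>UNIV. \<Sum>p\<in>UNIV. \<Sum>s\<in>UNIV. \<Sum>q\<in>UNIV. X s e p q)"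
      by (rule sum.cong[OF refl sum.swap])
    also have "\<dots> = (\<Sum>e\<in>UNIV. \<Sum>p\<in>UNIV. \<Sum>q\<in>UNIV. \<Sum>s\<in>UNIV. X s e p q)"
      by (rule sum.cong[OF refl sum.cong[OF refl sum.swap]])
    finally show ?thesis .
  qed
  have T1: "(\<Sum>s\<in>UNIV. ?c e p q * (?i s p * pd e L y * (if s = q then 1 else 0)))
      = ?c e p q * ?i q p * pd e L y" for e p q
    by (simp add: sum_distrib_left[symmetric] if_distrib[of "\<lambda>t. _ * t"] cong: if_cong)
  have T2: "(\<Sum>s\<in>UNIV. ?c e p q * (?i s p * pd s (pd e L) y * y $ q)) = ?c e p q * (if p = e then 1 else 0) * y $ q"
    for e p q
  proof -
    have "(\<Sum>s\<in>UNIV. ?c e p q * (?i s p * pd s (pd e L) y * y $ q))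
        = ?c e p q * (\<Sum>s\<in>UNIV. ?i p s * pd s (pd e L) y) * y $ q"
      by (simp add: sum_distrib_left sum_distrib_right metric_inv_sym[OF y, of p] mult_ac)
    then show ?thesis by (simp only: metric_inv_metric[OF y])
  qed
  have T3: "(\<Sum>s\<in>UNIV. ?c e p q * (?di s p * pd e L y * y $ q))
      = - (cc e p q * (mean_cartan_up L p y * pd e L y * y $ q))" for e p q
  proof -
    have "(\<Sum>s\<in>UNIV. ?c e p q * (?di s p * pd e L y * y $ q)) = ?c e p q * (\<Sum>s\<in>UNIV. ?di s p) * pd e L y * y $ q"
      by (simp add: sum_distrib_left sum_distrib_right mult_ac)
    then show ?thesis by (simp add: divergence_metric_inv[OF y])
  qed
  \<comment> \<open>Exchanging the names \<open>p\<close> and \<open>q\<close> shows that the sum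
    equals its own negative.\<close>
  have anti: "(\<Sum>p\<in>UNIV. \<Sum>q\<in>UNIV. ?c e p q * ?i q p * pd e L y) = 0" for e
  proof -
    let ?S = "\<Sum>p\<in>UNIV. \<Sum>q\<in>UNIV. ?c e p q * ?i q p * pd e L y"
    have "?S = (\<Sum>q\<in>UNIV. \<Sum>p\<in>UNIV. ?c e p q * ?i q p * pd e L y)" by (rule sum.swap)
    also have "\<dots> = (\<Sum>q\<in>UNIV. \<Sum>p\<in>UNIV. - (?c e q p * ?i p q * pd e L y))"
    proof (intro sum.cong refl)
      fix p q
      show "?c e p q * ?i q p * pd e L y = - (?c e q p * ?i p q * pd e L y)"
        using antisym[of e p q] metric_inv_sym[OF y, of p q] by simp
    qed
    also have "\<dots> = - ?S" by (simp only: sum_negf)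
    finally show ?thesis by simp
  qed
  have K1: "(\<Sum>s\<in>UNIV. \<Sum>p\<in>UNIV. \<Sum>q\<in>UNIV. K s p q * (y $ p * (if s = q then 1 else 0) + (if s = p then 1 else 0) * y $ q))
      = (\<Sum>q\<in>UNIV. (\<Sum>s\<in>UNIV. K s q s + K s s q) * y $ q)"
  proof -
    have "(\<Sum>p\<in>UNIV. \<Sum>q\<in>UNIV. K s p q * (y $ p * (if s = q then 1 else 0) + (if s = p then 1 else 0) * y $ q))
      = (\<Sum>p\<in>UNIV. K s p s * y $ p) + (\<Sum>q\<in>UNIV. K s s q * y $ q)" for s
    proof -
      have "(\<Sum>p\<in>UNIV. \<Sum>q\<in>UNIV. K s p q * ((if s = p then 1 else 0) * y $ q))
        = (\<Sum>q\<in>UNIV. \<Sum>p\<in>UNIV. K s p q * ((if s = p then 1 else 0) * y $ q))" by (rule sum.swap)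
      then show ?thesis
        by (simp add: distrib_left sum.distrib if_distrib[of "\<lambda>t. t * _"] if_distrib[of "\<lambda>t. _ * t"] cong: if_cong)
    qed
    then have "(\<Sum>s\<in>UNIV. \<Sum>p\<in>UNIV. \<Sum>q\<in>UNIV. K s p q * (y $ p * (if s = q then 1 else 0) + (if s = p then 1 else 0) * y $ q))
      = (\<Sum>s\<in>UNIV. \<Sum>q\<in>UNIV. (K s q s + K s s q) * y $ q)"
      by (simp add: sum.distrib distrib_right)
    also have "\<dots> = (\<Sum>q\<in>UNIV. \<Sum>s\<in>UNIV. (K s q s + K s s q) * y $ q)" by (rule sum.swap)
    finally show ?thesis by (simp only: sum_distrib_right)
  qed
  have "(\<Sum>s\<in>UNIV. pd s (frame_spray cc K s) y) =
      (\<Sum>s\<in>UNIV. \<Sum>e\<in>UNIV. \<Sum>p\<in>UNIV. \<Sum>q\<in>UNIV. ?c e p q * (?i s p * pd e L y * (if s = q then 1 else 0)))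
    + (\<Sum>s\<in>UNIV. \<Sum>e\<in>UNIV. \<Sum>p\<in>UNIV. \<Sum>q\<in>UNIV. ?c e p q * (?i s p * pd s (pd e L) y * y $ q))
    + (\<Sum>s\<in>UNIV. \<Sum>e\<in>UNIV. \<Sum>p\<in>UNIV. \<Sum>q\<in>UNIV. ?c e p q * (?di s p * pd e L y * y $ q))
    + (\<Sum>s\<in>UNIV. \<Sum>p\<in>UNIV. \<Sum>q\<in>UNIV. K s p q * (y $ p * (if s = q then 1 else 0) + (if s = p then 1 else 0) * y $ q))"
    by (simp only: pd_frame_spray[OF y] distrib_left distrib_right sum.distrib add.assoc)
  also have "\<dots> = (\<Sum>e\<in>UNIV. \<Sum>p\<in>UNIV. \<Sum>q\<in>UNIV. ?c e p q * (if p = e then 1 else 0) * y $ q)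
    - (\<Sum>e\<in>UNIV. \<Sum>p\<in>UNIV. \<Sum>q\<in>UNIV. cc e p q * (mean_cartan_up L p y * pd e L y * y $ q))
    + (\<Sum>q\<in>UNIV. (\<Sum>s\<in>UNIV. K s q s + K s s q) * y $ q)"
    unfolding swap T1 T2 T3 anti K1 by (simp add: sum_negf)
  also have "(\<Sum>e\<in>UNIV. \<Sum>p\<in>UNIV. \<Sum>q\<in>UNIV. ?c e p q * (if p = e then 1 else 0) * y $ q)
      = (\<Sum>q\<in>UNIV. (\<Sum>p\<in>UNIV. ?c p p q) * y $ q)"
  proof -
    have "(\<Sum>p\<in>UNIV. \<Sum>q\<in>UNIV. ?c e p q * (if p = e then 1 else 0) * y $ q) = (\<Sum>q\<in>UNIV. ?c e e q * y $ q)" for e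
      by (subst sum.swap) (simp add: if_distrib[of "\<lambda>t. t * _"] if_distrib[of "\<lambda>t. _ * t"] cong: if_cong)
    then have "(\<Sum>e\<in>UNIV. \<Sum>p\<in>UNIV. \<Sum>q\<in>UNIV. ?c e p q * (if p = e then 1 else 0) * y $ q)
        = (\<Sum>e\<in>UNIV. \<Sum>q\<in>UNIV. ?c e e q * y $ q)" by (simp only:)
    also have "\<dots> = (\<Sum>q\<in>UNIV. \<Sum>e\<in>UNIV. ?c e e q * y $ q)" by (rule sum.swap)
    finally show ?thesis by (simp only: sum_distrib_right)
  qed
  finally show ?thesis by (simp add: distrib_right sum.distrib)
qed

end


section \<open>The spray in local coordinates\<close>

lemma has_derivative_vecI:
  fixes f :: "'a::real_normed_vector \<Rightarrow> real^'n::finite"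
  assumes "\<And>a. ((\<lambda>x. f x $ a) has_derivative (\<lambda>h. f' h $ a)) (at x)"
  shows "(f has_derivative f') (at x)"
  unfolding has_derivative_componentwise_within[of f]
proof
  fix i :: "real^'n" assume "i \<in> Basis"
  then obtain a where "i = axis a 1" by (auto simp: Basis_vec_def)
  then show "((\<lambda>x. f x \<bullet> i) has_derivative (\<lambda>h. f' h \<bullet> i)) (at x)"
    using assms[of a] by (simp add: inner_axis)
qed

locale moving_frame = frame_lagrangian L W for L :: "real^'m::finite \<Rightarrow> real" and W +
  fixes F :: "real^'m \<Rightarrow> real^'m \<Rightarrow> real" and B :: "real^'m \<Rightarrow> real^'m^'m" and S :: "(real^'m) set"
    and x :: "real^'m" and cc :: "'m \<Rightarrow> 'm \<Rightarrow> 'm \<Rightarrow> real"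
  assumes open_S: "open S" and x_in_S: "x \<in> S"
    and B_diff: "\<And>\<xi> a \<sigma>. \<xi> \<in> S \<Longrightarrow> (\<lambda>\<xi>. B \<xi> $ a $ \<sigma>) differentiable (at \<xi>)"
    and B_inv: "invertible (B x)"
    and F_eq: "\<And>\<xi> u. \<xi> \<in> S \<Longrightarrow> B \<xi> *v u \<in> W \<Longrightarrow> F \<xi> u = L (B \<xi> *v u)"
    \<comment> \<open>\<open>c\<^sup>e\<^sub>p\<^sub>q = - de\<^sup>e(e\<^sub>p, e\<^sub>q)\<close> for the coframe \<open>e\<^sup>e = B\<^sup>e\<^sub>\<sigma> dx\<^sup>\<sigma>\<close>\<close>
    and cc_eq: "\<And>e p q. cc e p q = (\<Sum>\<sigma>\<in>UNIV. \<Sum>\<rho>\<in>UNIV. matrix_inv (B x) $ \<sigma> $ p * matrix_inv (B x) $ \<rho> $ q *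
      (pd \<rho> (\<lambda>\<xi>. B \<xi> $ e $ \<sigma>) x - pd \<sigma> (\<lambda>\<xi>. B \<xi> $ e $ \<rho>) x))"
begin

abbreviation E :: "real^'m^'m" where "E \<equiv> matrix_inv (B x)"
abbreviation dB :: "'m \<Rightarrow> 'm \<Rightarrow> 'm \<Rightarrow> real" where "dB \<rho> a \<sigma> \<equiv> pd \<rho> (\<lambda>\<xi>. B \<xi> $ a $ \<sigma>) x"

lemma B_E: "(\<Sum>k\<in>UNIV. B x $ i $ k * E $ k $ j) = (if i = j then 1 else 0)"
  by (rule matrix_inv_nth(1)[OF B_inv])

lemma E_apply: "(\<Sum>q\<in>UNIV. E $ \<rho> $ q * (B x *v u) $ q) = u $ \<rho>"
proof -
  have "E *v (B x *v u) = u"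
    by (simp add: matrix_vector_mul_assoc matrix_inv[OF B_inv])
  moreover have "(E *v w) $ \<rho> = (\<Sum>q\<in>UNIV. E $ \<rho> $ q * w $ q)" for w
    by (simp add: matrix_vector_mult_def)
  ultimately show ?thesis by metis
qed

lemma B_apply_has_derivative:
  assumes "\<xi> \<in> S"
  shows "((\<lambda>\<xi>. B \<xi> *v u) has_derivative
    (\<lambda>h. \<chi> a. \<Sum>\<sigma>\<in>UNIV. (\<Sum>\<rho>\<in>UNIV. pd \<rho> (\<lambda>\<xi>. B \<xi> $ a $ \<sigma>) \<xi> * h $ \<rho>) * u $ \<sigma>)) (at \<xi>)"
  by (rule has_derivative_vecI)
     (auto simp: matrix_vector_mult_def intro!: has_derivative_sum has_derivative_mult_left
        has_derivative_pd B_diff assms)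

lemma open_fibre: "open {u. B \<xi> *v u \<in> W}"
  using open_vimage[OF open_W, of "\<lambda>u. B \<xi> *v u"] by (simp add: vimage_def linear_continuous_on)

text \<open>A derivative in the base point is taken at fixed \<open>u\<close>, while
  \<open>F\<close> is given by \<open>L\<close> only where \<open>B \<xi> *v u\<close> lies in the
  cone. This is the neighbourhood on which \<open>F\<close> may be replaced;
  \<open>open_fibre\<close> serves the same purpose for derivatives in \<open>u\<close>.\<close>

lemma open_base: "open {\<xi> \<in> S. B \<xi> *v u \<in> W}"
proof -
  have "continuous_on S (\<lambda>\<xi>. B \<xi> *v u)"
    using B_apply_has_derivative
    by (intro continuous_at_imp_continuous_on ballI differentiable_imp_continuous_within) (blast intro: differentiableI)
  from continuous_open_preimage[OF this open_S open_W] show ?thesis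
    by (simp add: vimage_def Int_def)
qed

lemma pd_F:
  assumes "\<xi> \<in> S" "B \<xi> *v u \<in> W"
  shows "pd \<sigma> (F \<xi>) u = (\<Sum>a\<in>UNIV. B \<xi> $ a $ \<sigma> * pd a L (B \<xi> *v u))"
proof -
  have "pd \<sigma> (F \<xi>) u = pd \<sigma> (\<lambda>u. L (B \<xi> *v u)) u"
    by (rule pd_cong[OF open_fibre]) (use assms F_eq in auto)
  then show ?thesis using assms(2) by (simp add: pd_compose_linear L_diff)
qed

lemma metric_F:
  assumes u: "B x *v u \<in> W"
  shows "metric (F x) u = transpose (B x) ** metric L (B x *v u) ** B x"
proof -
  have "metric (F x) u $ i $ j = (transpose (B x) ** metric L (B x *v u) ** B x) $ i $ j" for i j
  proof -
    have "pd i (pd j (F x)) u = pd i (\<lambda>u. \<Sum>a\<in>UNIV. B x $ a $ j * pd a L (B x *v u)) u"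
      by (rule pd_cong[OF open_fibre]) (use u pd_F x_in_S in auto)
    also have "\<dots> = (\<Sum>a\<in>UNIV. B x $ a $ j * (\<Sum>b\<in>UNIV. B x $ b $ i * pd b (pd a L) (B x *v u)))"
    proof -
      have lin: "((\<lambda>z. B x *v z) has_derivative (\<lambda>z. B x *v z)) (at u)"
        by (rule linear_imp_has_derivative) simp
      have "(\<lambda>u. pd a L (B x *v u)) differentiable (at u)" for a
        using has_derivative_compose[OF lin has_derivative_pd[OF dL_diff[OF u]]] differentiableI by blast
      then show ?thesis by (simp add: pd_sum pd_cmult pd_compose_linear dL_diff u)
    qed
    finally show ?thesis
      by (simp add: metric_nth metric_def[of "F x"] matrix_matrix_mult_def transpose_def
          sum_distrib_left sum_distrib_right mult_ac)
  qed
  then show ?thesis by (simp add: vec_eq_iff)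
qed

text \<open>The metric of \<open>F\<close> is the pullback \<open>B^T g B\<close>, so the candidate
  for its inverse is \<open>E g^{-1} E^T\<close>; for square matrices checking one side is
  enough.\<close>

lemma metric_inv_F:
  assumes u: "B x *v u \<in> W"
  shows "metric_inv (F x) u $ \<mu> $ \<sigma> = (\<Sum>r\<in>UNIV. \<Sum>p\<in>UNIV. E $ \<mu> $ r * metric_inv L (B x *v u) $ r $ p * E $ \<sigma> $ p)"
proof -
  let ?g = "metric L (B x *v u)"
  have "transpose (B x) ** ?g ** B x ** (E ** matrix_inv ?g ** transpose E)
      = transpose (B x) ** (?g ** ((B x ** E) ** matrix_inv ?g)) ** transpose E"
    by (simp only: matrix_mul_assoc)
  also have "\<dots> = transpose (E ** B x)"
    by (simp only: matrix_inv(1)[OF B_inv] matrix_inv[OF nondegenerate[OF u]] matrix_mul_lid matrix_mul_rid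
        matrix_transpose_mul)
  also have "\<dots> = mat 1" by (simp add: matrix_inv[OF B_inv])
  finally have "metric_inv (F x) u = E ** matrix_inv ?g ** transpose E"
    unfolding metric_inv_def metric_F[OF u] by (rule matrix_inv_eqI)
  then have "metric_inv (F x) u $ \<mu> $ \<sigma>
      = (\<Sum>p\<in>UNIV. \<Sum>r\<in>UNIV. E $ \<mu> $ r * metric_inv L (B x *v u) $ r $ p * E $ \<sigma> $ p)"
    by (simp add: matrix_matrix_mult_def transpose_def metric_inv_def sum_distrib_right)
  then show ?thesis by (subst sum.swap)
qed

lemma pd_base:
  assumes f: "f differentiable (at (B x *v u))"
  shows "pd \<rho> (\<lambda>\<xi>. f (B \<xi> *v u)) x = (\<Sum>b\<in>UNIV. pd b f (B x *v u) * (\<Sum>\<sigma>\<in>UNIV. dB \<rho> b \<sigma> * u $ \<sigma>))"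
    and "(\<lambda>\<xi>. f (B \<xi> *v u)) differentiable (at x)"
proof -
  show "pd \<rho> (\<lambda>\<xi>. f (B \<xi> *v u)) x = (\<Sum>b\<in>UNIV. pd b f (B x *v u) * (\<Sum>\<sigma>\<in>UNIV. dB \<rho> b \<sigma> * u $ \<sigma>))"
    by (subst pd_compose[OF f B_apply_has_derivative[OF x_in_S]])
       (simp add: axis_def if_distrib[of "\<lambda>t. _ * t"] cong: if_cong)
  show "(\<lambda>\<xi>. f (B \<xi> *v u)) differentiable (at x)"
    using has_derivative_compose[OF B_apply_has_derivative[OF x_in_S] has_derivative_pd[OF f]] differentiableI
    by blast
qed

lemma pd_base_F:
  assumes u: "B x *v u \<in> W"
  shows "pd \<sigma> (\<lambda>\<xi>. F \<xi> u) x = (\<Sum>b\<in>UNIV. pd b L (B x *v u) * (\<Sum>\<rho>\<in>UNIV. dB \<sigma> b \<rho> * u $ \<rho>))"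
proof -
  have "pd \<sigma> (\<lambda>\<xi>. F \<xi> u) x = pd \<sigma> (\<lambda>\<xi>. L (B \<xi> *v u)) x"
    by (rule pd_cong[OF open_base[of u]]) (use u x_in_S F_eq in auto)
  then show ?thesis by (simp add: pd_base L_diff u)
qed

text \<open>The base point occurs twice in \<open>pd \<sigma> (F \<xi>) u\<close>, inside the
  argument of \<open>y_a\<close> and in the explicit factor \<open>B\<close>. The first summand will
  produce the quadratic remainder of the spray, the second one half of the antisymmetrised
  derivative of the coframe.\<close>

lemma pd_base_pd_F:
  assumes u: "B x *v u \<in> W"
  shows "pd \<rho> (\<lambda>\<xi>. pd \<sigma> (F \<xi>) u) x = (\<Sum>a\<in>UNIV.
    B x $ a $ \<sigma> * (\<Sum>b\<in>UNIV. pd b (pd a L) (B x *v u) * (\<Sum>\<tau>\<in>UNIV. dB \<rho> b \<tau> * u $ \<tau>))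
    + dB \<rho> a \<sigma> * pd a L (B x *v u))"
proof -
  have "pd \<rho> (\<lambda>\<xi>. pd \<sigma> (F \<xi>) u) x = pd \<rho> (\<lambda>\<xi>. \<Sum>a\<in>UNIV. B \<xi> $ a $ \<sigma> * pd a L (B \<xi> *v u)) x"
    by (rule pd_cong[OF open_base[of u]]) (use u x_in_S pd_F in auto)
  then show ?thesis
    by (simp add: pd_sum pd_mult pd_base dL_diff u B_diff x_in_S)
qed

text \<open>Half the quadratic form \<open>(d_\<rho> B^r_\<sigma>) u^\<rho> u^\<sigma>\<close>,
  rewritten in \<open>y\<close> by means of \<open>u = E y\<close>; the factor 1/2 is that of the
  spray. The coefficients are not symmetrised in \<open>p\<close> and \<open>q\<close>, since only
  the quadratic form is meant.\<close>

definition K :: "'m \<Rightarrow> 'm \<Rightarrow> 'm \<Rightarrow> real" where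
  "K r p q = 1/2 * (\<Sum>\<rho>\<in>UNIV. \<Sum>\<sigma>\<in>UNIV. dB \<rho> r \<sigma> * E $ \<rho> $ p * E $ \<sigma> $ q)"

lemma K_apply:
  "(\<Sum>p\<in>UNIV. \<Sum>q\<in>UNIV. K r p q * ((B x *v u) $ p * (B x *v u) $ q))
    = 1/2 * (\<Sum>\<rho>\<in>UNIV. (\<Sum>\<sigma>\<in>UNIV. dB \<rho> r \<sigma> * u $ \<sigma>) * u $ \<rho>)"
proof -
  let ?y = "B x *v u"
  let ?X = "\<lambda>p q \<rho> \<sigma>. dB \<rho> r \<sigma> * E $ \<rho> $ p * E $ \<sigma> $ q * (?y $ p * ?y $ q)"
  have "(\<Sum>p\<in>UNIV. \<Sum>q\<in>UNIV. \<Sum>\<rho>\<in>UNIV. \<Sum>\<sigma>\<in>UNIV. ?X p q \<rho> \<sigma>)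
    = (\<Sum>\<rho>\<in>UNIV. \<Sum>\<sigma>\<in>UNIV. \<Sum>p\<in>UNIV. \<Sum>q\<in>UNIV. ?X p q \<rho> \<sigma>)"
  proof -
    have rotate: "(\<Sum>p\<in>UNIV. \<Sum>q\<in>UNIV. \<Sum>s\<in>UNIV. Y p q s) = (\<Sum>s\<in>UNIV. \<Sum>p\<in>UNIV. \<Sum>q\<in>UNIV. Y p q s)"
      for Y :: "'m \<Rightarrow> 'm \<Rightarrow> 'm \<Rightarrow> real"
    proof -
      have "(\<Sum>p\<in>UNIV. \<Sum>q\<in>UNIV. \<Sum>s\<in>UNIV. Y p q s) = (\<Sum>p\<in>UNIV. \<Sum>s\<in>UNIV. \<Sum>q\<in>UNIV. Y p q s)"
        by (rule sum.cong[OF refl sum.swap])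
      also have "\<dots> = (\<Sum>s\<in>UNIV. \<Sum>p\<in>UNIV. \<Sum>q\<in>UNIV. Y p q s)" by (rule sum.swap)
      finally show ?thesis .
    qed
    show ?thesis by (subst rotate) (rule sum.cong[OF refl rotate])
  qed
  also have "\<dots> = (\<Sum>\<rho>\<in>UNIV. \<Sum>\<sigma>\<in>UNIV. dB \<rho> r \<sigma> * (\<Sum>p\<in>UNIV. E $ \<rho> $ p * ?y $ p) * (\<Sum>q\<in>UNIV. E $ \<sigma> $ q * ?y $ q))"
    by (simp add: sum_distrib_left sum_distrib_right mult_ac)
  also have "\<dots> = (\<Sum>\<rho>\<in>UNIV. (\<Sum>\<sigma>\<in>UNIV. dB \<rho> r \<sigma> * u $ \<sigma>) * u $ \<rho>)"
    by (simp only: E_apply) (simp add: sum_distrib_left mult_ac)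
  finally have "(\<Sum>p\<in>UNIV. \<Sum>q\<in>UNIV. \<Sum>\<rho>\<in>UNIV. \<Sum>\<sigma>\<in>UNIV. ?X p q \<rho> \<sigma>)
    = (\<Sum>\<rho>\<in>UNIV. (\<Sum>\<sigma>\<in>UNIV. dB \<rho> r \<sigma> * u $ \<sigma>) * u $ \<rho>)" .
  moreover have "(\<Sum>p\<in>UNIV. \<Sum>q\<in>UNIV. K r p q * (?y $ p * ?y $ q))
      = (\<Sum>p\<in>UNIV. \<Sum>q\<in>UNIV. 1/2 * (\<Sum>\<rho>\<in>UNIV. \<Sum>\<sigma>\<in>UNIV. ?X p q \<rho> \<sigma>))"
    by (simp only: K_def sum_distrib_right mult.assoc)
  moreover have "\<dots> = 1/2 * (\<Sum>p\<in>UNIV. \<Sum>q\<in>UNIV. \<Sum>\<rho>\<in>UNIV. \<Sum>\<sigma>\<in>UNIV. ?X p q \<rho> \<sigma>)"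
    by (simp only: sum_distrib_left)
  ultimately show ?thesis by (simp only:)
qed

lemma cc_apply:
  "(\<Sum>q\<in>UNIV. cc e p q * (B x *v u) $ q)
    = (\<Sum>\<sigma>\<in>UNIV. E $ \<sigma> $ p * (\<Sum>\<rho>\<in>UNIV. u $ \<rho> * (dB \<rho> e \<sigma> - dB \<sigma> e \<rho>)))"
proof -
  let ?y = "B x *v u"
  let ?X = "\<lambda>q \<sigma> \<rho>. E $ \<sigma> $ p * E $ \<rho> $ q * (dB \<rho> e \<sigma> - dB \<sigma> e \<rho>) * ?y $ q"
  have "(\<Sum>q\<in>UNIV. cc e p q * ?y $ q) = (\<Sum>q\<in>UNIV. \<Sum>\<sigma>\<in>UNIV. \<Sum>\<rho>\<in>UNIV. ?X q \<sigma> \<rho>)"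
    by (simp add: cc_eq sum_distrib_right)
  also have "\<dots> = (\<Sum>\<sigma>\<in>UNIV. \<Sum>q\<in>UNIV. \<Sum>\<rho>\<in>UNIV. ?X q \<sigma> \<rho>)" by (rule sum.swap)
  also have "\<dots> = (\<Sum>\<sigma>\<in>UNIV. \<Sum>\<rho>\<in>UNIV. \<Sum>q\<in>UNIV. ?X q \<sigma> \<rho>)"
    by (rule sum.cong[OF refl sum.swap])
  also have "\<dots> = (\<Sum>\<sigma>\<in>UNIV. \<Sum>\<rho>\<in>UNIV. E $ \<sigma> $ p * (\<Sum>q\<in>UNIV. E $ \<rho> $ q * ?y $ q) * (dB \<rho> e \<sigma> - dB \<sigma> e \<rho>))"
    by (simp only: sum_distrib_left sum_distrib_right mult_ac)
  finally show ?thesis by (simp add: E_apply sum_distrib_left mult.assoc)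
qed

text \<open>In the covector \<open>X\<close> the derivative of the argument of \<open>y_a\<close>
  yields \<open>g_{ab}\<close> times the vector \<open>?q\<close>, and raising the index gives
  \<open>?q\<close> back whatever \<open>L\<close> is: this is the \<open>K\<close> part. The other
  two terms join into \<open>y_e\<close> times the antisymmetrised derivative of the coframe, which
  after contraction with the frame is \<open>cc\<close>.\<close>

lemma spray_F:
  assumes u: "B x *v u \<in> W"
  shows "spray F \<mu> x u = (\<Sum>r\<in>UNIV. E $ \<mu> $ r * frame_spray cc K r (B x *v u))"
proof -
  let ?y = "B x *v u"
  let ?i = "\<lambda>r p. metric_inv L ?y $ r $ p"
  let ?l = "\<lambda>a. pd a L ?y"
  let ?Bu = "\<lambda>\<rho> b. \<Sum>\<tau>\<in>UNIV. dB \<rho> b \<tau> * u $ \<tau>"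
  let ?q = "\<lambda>b. \<Sum>\<rho>\<in>UNIV. ?Bu \<rho> b * u $ \<rho>"
  define X where "X \<sigma> = (\<Sum>\<rho>\<in>UNIV. pd \<rho> (\<lambda>\<xi>. pd \<sigma> (F \<xi>) u) x * u $ \<rho>) - pd \<sigma> (\<lambda>\<xi>. F \<xi> u) x" for \<sigma>
  have X: "X \<sigma> = (\<Sum>a\<in>UNIV. B x $ a $ \<sigma> * (\<Sum>b\<in>UNIV. pd a (pd b L) ?y * ?q b))
      + (\<Sum>e\<in>UNIV. ?l e * (\<Sum>\<rho>\<in>UNIV. u $ \<rho> * (dB \<rho> e \<sigma> - dB \<sigma> e \<rho>)))" for \<sigma>
  proof -
    have 1: "(\<Sum>\<rho>\<in>UNIV. (\<Sum>a\<in>UNIV. B x $ a $ \<sigma> * (\<Sum>b\<in>UNIV. pd b (pd a L) ?y * G \<rho> b)) * u $ \<rho>)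
        = (\<Sum>a\<in>UNIV. B x $ a $ \<sigma> * (\<Sum>b\<in>UNIV. pd a (pd b L) ?y * (\<Sum>\<rho>\<in>UNIV. G \<rho> b * u $ \<rho>)))"
      for G :: "'m \<Rightarrow> 'm \<Rightarrow> real"
    proof -
      have "(\<Sum>\<rho>\<in>UNIV. (\<Sum>a\<in>UNIV. B x $ a $ \<sigma> * (\<Sum>b\<in>UNIV. pd b (pd a L) ?y * G \<rho> b)) * u $ \<rho>)
          = (\<Sum>\<rho>\<in>UNIV. \<Sum>a\<in>UNIV. B x $ a $ \<sigma> * (\<Sum>b\<in>UNIV. pd a (pd b L) ?y * G \<rho> b * u $ \<rho>))"
        by (simp only: sum_distrib_right sum_distrib_left mult.assoc metric_sym[OF u])
      also have "\<dots> = (\<Sum>a\<in>UNIV. \<Sum>\<rho>\<in>UNIV. B x $ a $ \<sigma> * (\<Sum>b\<in>UNIV. pd a (pd b L) ?y * G \<rho> b * u $ \<rho>))"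
        by (rule sum.swap)
      also have "\<dots> = (\<Sum>a\<in>UNIV. B x $ a $ \<sigma> * (\<Sum>\<rho>\<in>UNIV. \<Sum>b\<in>UNIV. pd a (pd b L) ?y * G \<rho> b * u $ \<rho>))"
        by (simp only: sum_distrib_left)
      also have "\<dots> = (\<Sum>a\<in>UNIV. B x $ a $ \<sigma> * (\<Sum>b\<in>UNIV. \<Sum>\<rho>\<in>UNIV. pd a (pd b L) ?y * G \<rho> b * u $ \<rho>))"
        by (subst sum.swap) (rule refl)
      also have "\<dots> = (\<Sum>a\<in>UNIV. B x $ a $ \<sigma> * (\<Sum>b\<in>UNIV. pd a (pd b L) ?y * (\<Sum>\<rho>\<in>UNIV. G \<rho> b * u $ \<rho>)))"
        by (simp only: sum_distrib_left mult.assoc)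
      finally show ?thesis .
    qed
    have 2: "(\<Sum>\<rho>\<in>UNIV. (\<Sum>a\<in>UNIV. dB \<rho> a \<sigma> * ?l a) * u $ \<rho>) - (\<Sum>e\<in>UNIV. ?l e * (\<Sum>\<rho>\<in>UNIV. dB \<sigma> e \<rho> * u $ \<rho>))
        = (\<Sum>e\<in>UNIV. ?l e * (\<Sum>\<rho>\<in>UNIV. u $ \<rho> * (dB \<rho> e \<sigma> - dB \<sigma> e \<rho>)))"
    proof -
      have "(\<Sum>\<rho>\<in>UNIV. (\<Sum>a\<in>UNIV. dB \<rho> a \<sigma> * ?l a) * u $ \<rho>) = (\<Sum>\<rho>\<in>UNIV. \<Sum>a\<in>UNIV. dB \<rho> a \<sigma> * ?l a * u $ \<rho>)"
        by (simp only: sum_distrib_right)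
      also have "\<dots> = (\<Sum>a\<in>UNIV. \<Sum>\<rho>\<in>UNIV. dB \<rho> a \<sigma> * ?l a * u $ \<rho>)" by (rule sum.swap)
      finally show ?thesis
        by (simp add: right_diff_distrib sum_subtractf sum_distrib_left mult_ac)
    qed
    show ?thesis
      unfolding X_def pd_base_F[OF u] pd_base_pd_F[OF u] sum.distrib distrib_right 1 2[symmetric]
      by simp
  qed
  \<comment> \<open>Passing to frame components cancels \<open>B\<close> against \<open>E\<close> in
    the Hessian part and turns the exterior derivative into \<open>cc\<close> in the other.\<close>
  have EX: "(\<Sum>\<sigma>\<in>UNIV. E $ \<sigma> $ p * X \<sigma>)
      = (\<Sum>b\<in>UNIV. pd p (pd b L) ?y * ?q b) + (\<Sum>e\<in>UNIV. \<Sum>q\<in>UNIV. cc e p q * (?l e * ?y $ q))" for p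
  proof -
    let ?Z = "\<lambda>a. \<Sum>b\<in>UNIV. pd a (pd b L) ?y * ?q b"
    let ?V = "\<lambda>e \<sigma>. \<Sum>\<rho>\<in>UNIV. u $ \<rho> * (dB \<rho> e \<sigma> - dB \<sigma> e \<rho>)"
    have "(\<Sum>\<sigma>\<in>UNIV. E $ \<sigma> $ p * (\<Sum>a\<in>UNIV. B x $ a $ \<sigma> * ?Z a)) = (\<Sum>\<sigma>\<in>UNIV. \<Sum>a\<in>UNIV. B x $ a $ \<sigma> * E $ \<sigma> $ p * ?Z a)"
      by (simp only: sum_distrib_left[of "E $ _ $ _"] mult_ac)
    also have "\<dots> = (\<Sum>a\<in>UNIV. \<Sum>\<sigma>\<in>UNIV. B x $ a $ \<sigma> * E $ \<sigma> $ p * ?Z a)" by (rule sum.swap)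
    also have "\<dots> = ?Z p"
      by (simp only: sum_distrib_right[symmetric] B_E) (simp add: if_distrib[of "\<lambda>t. t * _"] cong: if_cong)
    finally have 1: "(\<Sum>\<sigma>\<in>UNIV. E $ \<sigma> $ p * (\<Sum>a\<in>UNIV. B x $ a $ \<sigma> * ?Z a)) = ?Z p" .
    have "(\<Sum>\<sigma>\<in>UNIV. E $ \<sigma> $ p * (\<Sum>e\<in>UNIV. ?l e * ?V e \<sigma>)) = (\<Sum>\<sigma>\<in>UNIV. \<Sum>e\<in>UNIV. ?l e * (E $ \<sigma> $ p * ?V e \<sigma>))"
      by (simp only: sum_distrib_left[of "E $ _ $ _"] mult.left_commute)
    also have "\<dots> = (\<Sum>e\<in>UNIV. \<Sum>\<sigma>\<in>UNIV. ?l e * (E $ \<sigma> $ p * ?V e \<sigma>))" by (rule sum.swap)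
    also have "\<dots> = (\<Sum>e\<in>UNIV. ?l e * (\<Sum>q\<in>UNIV. cc e p q * ?y $ q))"
      by (simp only: cc_apply sum_distrib_left)
    also have "\<dots> = (\<Sum>e\<in>UNIV. \<Sum>q\<in>UNIV. cc e p q * (?l e * ?y $ q))"
      by (simp only: sum_distrib_left mult.left_commute)
    finally show ?thesis unfolding X by (simp only: distrib_left sum.distrib 1)
  qed
  have "spray F \<mu> x u = 1/2 * (\<Sum>\<sigma>\<in>UNIV. metric_inv (F x) u $ \<mu> $ \<sigma> * X \<sigma>)"
    by (simp only: spray_def X_def)
  also have "(\<Sum>\<sigma>\<in>UNIV. metric_inv (F x) u $ \<mu> $ \<sigma> * X \<sigma>)
      = (\<Sum>\<sigma>\<in>UNIV. \<Sum>r\<in>UNIV. E $ \<mu> $ r * (\<Sum>p\<in>UNIV. ?i r p * (E $ \<sigma> $ p * X \<sigma>)))"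
    by (simp only: metric_inv_F[OF u] sum_distrib_left sum_distrib_right mult.assoc)
  also have "\<dots> = (\<Sum>r\<in>UNIV. \<Sum>\<sigma>\<in>UNIV. E $ \<mu> $ r * (\<Sum>p\<in>UNIV. ?i r p * (E $ \<sigma> $ p * X \<sigma>)))"
    by (rule sum.swap)
  also have "\<dots> = (\<Sum>r\<in>UNIV. E $ \<mu> $ r * (\<Sum>\<sigma>\<in>UNIV. \<Sum>p\<in>UNIV. ?i r p * (E $ \<sigma> $ p * X \<sigma>)))"
    by (simp only: sum_distrib_left)
  also have "\<dots> = (\<Sum>r\<in>UNIV. E $ \<mu> $ r * (\<Sum>p\<in>UNIV. \<Sum>\<sigma>\<in>UNIV. ?i r p * (E $ \<sigma> $ p * X \<sigma>)))"
    by (subst (2) sum.swap) (rule refl)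
  also have "\<dots> = (\<Sum>r\<in>UNIV. E $ \<mu> $ r * (\<Sum>p\<in>UNIV. ?i r p * (\<Sum>\<sigma>\<in>UNIV. E $ \<sigma> $ p * X \<sigma>)))"
    by (simp only: sum_distrib_left)
  also have "1/2 * \<dots> = (\<Sum>r\<in>UNIV. E $ \<mu> $ r * (1/2 * (\<Sum>p\<in>UNIV. ?i r p * (\<Sum>\<sigma>\<in>UNIV. E $ \<sigma> $ p * X \<sigma>))))"
    by (rule trans[OF sum_distrib_left sum.cong[OF refl mult.left_commute]])
  also have "\<dots> = (\<Sum>r\<in>UNIV. E $ \<mu> $ r * frame_spray cc K r ?y)"
  proof (intro sum.cong refl arg_cong[where f = "\<lambda>t. _ * t"])
    fix r
    have "(\<Sum>p\<in>UNIV. ?i r p * (\<Sum>b\<in>UNIV. pd p (pd b L) ?y * ?q b)) = (\<Sum>p\<in>UNIV. \<Sum>b\<in>UNIV. ?i r p * pd p (pd b L) ?y * ?q b)"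
      by (simp only: sum_distrib_left[of "metric_inv L ?y $ _ $ _"] mult.assoc)
    also have "\<dots> = (\<Sum>b\<in>UNIV. (\<Sum>p\<in>UNIV. ?i r p * pd p (pd b L) ?y) * ?q b)"
      by (subst sum.swap) (simp only: sum_distrib_right[of _ _ "sum _ _"])
    also have "\<dots> = ?q r"
      by (simp only: metric_inv_metric[OF u]) (simp add: if_distrib[of "\<lambda>t. t * _"] cong: if_cong)
    finally have 1: "(\<Sum>p\<in>UNIV. ?i r p * (\<Sum>b\<in>UNIV. pd p (pd b L) ?y * ?q b)) = ?q r" .
    have "(\<Sum>p\<in>UNIV. ?i r p * (\<Sum>e\<in>UNIV. \<Sum>q\<in>UNIV. cc e p q * (?l e * ?y $ q)))
        = (\<Sum>p\<in>UNIV. \<Sum>e\<in>UNIV. \<Sum>q\<in>UNIV. cc e p q * (?i r p * ?l e * ?y $ q))"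
      by (simp add: sum_distrib_left mult_ac)
    also have "\<dots> = (\<Sum>e\<in>UNIV. \<Sum>p\<in>UNIV. \<Sum>q\<in>UNIV. cc e p q * (?i r p * ?l e * ?y $ q))" by (rule sum.swap)
    finally show "1/2 * (\<Sum>p\<in>UNIV. ?i r p * (\<Sum>\<sigma>\<in>UNIV. E $ \<sigma> $ p * X \<sigma>)) = frame_spray cc K r ?y"
      unfolding EX distrib_left[of "metric_inv L ?y $ _ $ _"] sum.distrib 1 frame_spray_def K_apply
      by (simp add: sum_distrib_left distrib_left mult.assoc)
  qed
  finally show ?thesis .
qed

end


section \<open>The Douglas curvature in local coordinates\<close>

lemma pd_cong3:
  assumes "open S" "x \<in> S" "\<And>z. z \<in> S \<Longrightarrow> f z = g z"
  shows "pd a (pd b (pd c f)) x = pd a (pd b (pd c g)) x"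
  by (intro pd_cong[OF assms(1)] assms)

text \<open>Turns nested sums over indices into one sum over tuples, the form to which
  \<open>pd3_linear_combination\<close> applies.\<close>

lemma sum_UNIV_pair:
  "(\<Sum>t\<in>UNIV. f t) = (\<Sum>a\<in>UNIV. \<Sum>b\<in>UNIV. f (a :: 'a::finite, b :: 'b::finite))"
  by (simp add: sum.cartesian_product)

text \<open>The derivative of the product in a fixed direction is a bounded linear function of
  \<open>y\<close>, hence of every class C^n.\<close>

lemma Ck_on_nth_mult:
  assumes "open S"
  shows "Ck_on k (\<lambda>y :: real^'m::finite. y $ p * y $ q) S"
proof (cases k)
  case 0
  then show ?thesis by (simp add: continuous_intros)
next
  case (Suc n)
  show ?thesis unfolding Suc
  proof (rule Ck_on_SucI[OF assms])
    show "((\<lambda>y. y $ p * y $ q) has_derivative (\<lambda>v. y $ p * v $ q + v $ p * y $ q)) (at y)" for y :: "real^'m"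
      by (intro has_derivative_mult has_derivative_nth)
    show "Ck_on n (\<lambda>y. y $ p * v $ q + v $ p * y $ q) S" for v :: "real^'m"
      by (intro Ck_on_bounded_linear assms bounded_linear_intros bounded_linear_vec_nth)
  qed
qed

lemma pd3_nth_mult: "pd a (pd b (pd c (\<lambda>y :: real^'m::finite. y $ p * y $ q))) y = 0"
proof -
  have 1: "pd c (\<lambda>y. y $ p * y $ q) = (\<lambda>y. (if c = q then 1 else 0) * y $ p + (if c = p then 1 else 0) * y $ q)"
    for c and p q :: 'm by (rule ext) (simp add: pd_mult pd_nth)
  have 2: "pd b (\<lambda>y. s * y $ p + t * y $ q) = (\<lambda>y. s * (if b = p then 1 else 0) + t * (if b = q then 1 else 0))"
    for b p q :: 'm and s t by (rule ext) (simp add: pd_add pd_cmult pd_nth)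
  show ?thesis unfolding 1 2 by (subst pd_eq[OF has_derivative_const]) simp
qed

lemma pd3_linear_combination:
  assumes S: "open S" "x \<in> S" and f: "\<And>j. j \<in> J \<Longrightarrow> Ck_on 3 (f j) S" and J: "finite J"
  shows "pd a (pd b (pd c (\<lambda>y. \<Sum>j\<in>J. k j * f j y))) x = (\<Sum>j\<in>J. k j * pd a (pd b (pd c (f j))) x)"
proof -
  have f3: "Ck_on (Suc (Suc (Suc 0))) (f j) S" if "j \<in> J" for j using f[OF that] by (simp only: numeral_3_eq_3)
  have 1: "pd c (\<lambda>y. \<Sum>j\<in>J. k j * f j y) y = (\<Sum>j\<in>J. k j * pd c (f j) y)" if "y \<in> S" for y
    using that by (simp add: pd_sum pd_cmult Ck_on_differentiable[OF f3])
  have 2: "pd b (\<lambda>y. \<Sum>j\<in>J. k j * pd c (f j) y) y = (\<Sum>j\<in>J. k j * pd b (pd c (f j)) y)" if "y \<in> S" for y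
    using that by (simp add: pd_sum pd_cmult Ck_on_differentiable[OF Ck_on_pd[OF f3]])
  have 3: "pd a (\<lambda>y. \<Sum>j\<in>J. k j * pd b (pd c (f j)) y) x = (\<Sum>j\<in>J. k j * pd a (pd b (pd c (f j))) x)"
    using S by (simp add: pd_sum pd_cmult Ck_on_differentiable[OF Ck_on_pd[OF Ck_on_pd[OF f3]]])
  have "pd b (pd c (\<lambda>y. \<Sum>j\<in>J. k j * f j y)) y = (\<Sum>j\<in>J. k j * pd b (pd c (f j)) y)" if "y \<in> S" for y
    using pd_cong[OF S(1) that 1] 2[OF that] by simp
  from pd_cong[OF S this] 3 show ?thesis by simp
qed

context moving_frame
begin

lemma cc_antisym: "cc e p q = - cc e q p"
proof -
  have "cc e p q = (\<Sum>\<rho>\<in>UNIV. \<Sum>\<sigma>\<in>UNIV. E $ \<sigma> $ p * E $ \<rho> $ q * (dB \<rho> e \<sigma> - dB \<sigma> e \<rho>))"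
    unfolding cc_eq by (rule sum.swap)
  also have "\<dots> = (\<Sum>\<rho>\<in>UNIV. \<Sum>\<sigma>\<in>UNIV. - (E $ \<rho> $ q * E $ \<sigma> $ p * (dB \<sigma> e \<rho> - dB \<rho> e \<sigma>)))"
    by (intro sum.cong refl) (simp add: algebra_simps)
  also have "\<dots> = - cc e q p" by (simp only: sum_negf cc_eq)
  finally show ?thesis .
qed

text \<open>The matrix \<open>E\<close> does not depend on \<open>u\<close>, so differentiating
  \<open>spray_F\<close> only brings in a factor \<open>B\<close>, and in the trace \<open>B\<close>
  and \<open>E\<close> cancel: the divergence is invariant under the linear change of
  variables.\<close>

lemma trace_nonlinear_conn:
  assumes u: "B x *v u \<in> W"
  shows "(\<Sum>\<mu>\<in>UNIV. nonlinear_conn F \<mu> \<mu> x u) = (\<Sum>s\<in>UNIV. pd s (frame_spray cc K s) (B x *v u))"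
proof -
  let ?d = "\<lambda>s r. pd s (frame_spray cc K r) (B x *v u)"
  have lin: "((\<lambda>z. B x *v z) has_derivative (\<lambda>z. B x *v z)) (at u)"
    by (rule linear_imp_has_derivative) simp
  have d: "(\<lambda>z. frame_spray cc K r (B x *v z)) differentiable (at u)" for r
    using has_derivative_compose[OF lin has_derivative_pd[OF frame_spray_diff[OF u]]] differentiableI by blast
  have "nonlinear_conn F \<mu> \<mu> x u = (\<Sum>r\<in>UNIV. E $ \<mu> $ r * (\<Sum>s\<in>UNIV. B x $ s $ \<mu> * ?d s r))" for \<mu>
  proof -
    have "nonlinear_conn F \<mu> \<mu> x u = pd \<mu> (\<lambda>z. \<Sum>r\<in>UNIV. E $ \<mu> $ r * frame_spray cc K r (B x *v z)) u"
      unfolding nonlinear_conn_def by (rule pd_cong[OF open_fibre]) (use u spray_F in auto)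
    then show ?thesis by (simp add: pd_sum pd_cmult d pd_compose_linear frame_spray_diff u)
  qed
  then have "(\<Sum>\<mu>\<in>UNIV. nonlinear_conn F \<mu> \<mu> x u) = (\<Sum>\<mu>\<in>UNIV. \<Sum>r\<in>UNIV. \<Sum>s\<in>UNIV. B x $ s $ \<mu> * E $ \<mu> $ r * ?d s r)"
    by (simp add: sum_distrib_left mult_ac)
  also have "\<dots> = (\<Sum>r\<in>UNIV. \<Sum>\<mu>\<in>UNIV. \<Sum>s\<in>UNIV. B x $ s $ \<mu> * E $ \<mu> $ r * ?d s r)" by (rule sum.swap)
  also have "\<dots> = (\<Sum>r\<in>UNIV. \<Sum>s\<in>UNIV. \<Sum>\<mu>\<in>UNIV. B x $ s $ \<mu> * E $ \<mu> $ r * ?d s r)"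
    by (rule sum.cong[OF refl sum.swap])
  also have "\<dots> = (\<Sum>r\<in>UNIV. ?d r r)"
    by (simp only: sum_distrib_right[symmetric] B_E) (simp add: if_distrib[of "\<lambda>t. t * _"] cong: if_cong)
  finally show ?thesis .
qed

text \<open>The C^3 property of the corrected spray is not derived from its two parts; it is read
  off from the identity \<open>H_eq\<close>, which expresses it by potentials and quadratic
  monomials.\<close>

theorem douglas_frame_F:
  assumes pot: "\<And>r p e q. Ck_on 3 (douglas_potential L r p e q) W" and u: "B x *v u \<in> W"
  shows "douglas_frame F E (B x) r a b c x u
    = (\<Sum>e\<in>UNIV. \<Sum>p\<in>UNIV. \<Sum>q\<in>UNIV.
        cc e p q * pd a (pd b (pd c (douglas_potential L r p e q))) (B x *v u))"
proof -
  let ?k = "1 / (real CARD('m) + 1)"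
  \<comment> \<open>The frame components of the expression that the Douglas curvature
    differentiates.\<close>
  define H where "H r y = frame_spray cc K r y - ?k * (\<Sum>s\<in>UNIV. pd s (frame_spray cc K s) y) * y $ r" for r y
  \<comment> \<open>The coefficients of the linear form in the trace. Multiplied by
    \<open>y^r\<close> this form is quadratic, so it can be absorbed, together with
    \<open>K\<close>, into \<open>Q\<close>; the delta in \<open>Q\<close> supplies the factor
    \<open>y^r\<close>.\<close>
  define \<kappa> where "\<kappa> q = (\<Sum>p\<in>UNIV. 1/2 * cc p p q) + (\<Sum>s\<in>UNIV. K s q s + K s s q)" for q
  define Q where "Q r p q = K r p q - ?k * (\<kappa> p * (if q = r then 1 else 0))" for r p q
  define P where "P r = (\<lambda>(e, p, q). douglas_potential L r p e q)" for r
  define R where "R = (\<lambda>(p, q) (y::real^'m). y $ p * y $ q)"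
  \<comment> \<open>The minus sign of the Douglas correction meets the minus sign of the mean Cartan
    term in the divergence; this is why \<open>I^p y^r\<close> appears with a plus sign in the
    potential.\<close>
  have H_eq: "H r y = (\<Sum>t\<in>UNIV. (case t of (e, p, q) \<Rightarrow> cc e p q) * P r t y) + (\<Sum>t\<in>UNIV. (case t of (p, q) \<Rightarrow> Q r p q) * R t y)"
    if y: "y \<in> W" for r y
  proof -
    have "(\<Sum>p\<in>UNIV. \<Sum>q\<in>UNIV. ?k * (\<kappa> p * (if q = r then 1 else 0)) * (y $ p * y $ q)) = ?k * (\<Sum>q\<in>UNIV. \<kappa> q * y $ q) * y $ r"
    proof -
      have "(\<Sum>q\<in>UNIV. ?k * (\<kappa> p * (if q = r then 1 else 0)) * (y $ p * y $ q)) = ?k * (\<kappa> p * y $ p) * y $ r" for p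
      proof -
        have "(\<Sum>q\<in>UNIV. ?k * (\<kappa> p * (if q = r then 1 else 0)) * (y $ p * y $ q))
            = (\<Sum>q\<in>UNIV. if q = r then ?k * (\<kappa> p * y $ p) * y $ q else 0)"
          by (rule sum.cong) auto
        then show ?thesis by simp
      qed
      then show ?thesis by (simp only: sum_distrib_left sum_distrib_right)
    qed
    then have Q: "(\<Sum>p\<in>UNIV. \<Sum>q\<in>UNIV. Q r p q * (y $ p * y $ q))
        = (\<Sum>p\<in>UNIV. \<Sum>q\<in>UNIV. K r p q * (y $ p * y $ q)) - ?k * (\<Sum>q\<in>UNIV. \<kappa> q * y $ q) * y $ r"
      by (simp only: Q_def left_diff_distrib sum_subtractf)
    have pot_eq: "(\<Sum>e\<in>UNIV. \<Sum>p\<in>UNIV. \<Sum>q\<in>UNIV. cc e p q * douglas_potential L r p e q y)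
        = (\<Sum>e\<in>UNIV. \<Sum>p\<in>UNIV. \<Sum>q\<in>UNIV. (1/2 * cc e p q) * (metric_inv L y $ r $ p * pd e L y * y $ q))
        + ?k * (\<Sum>e\<in>UNIV. \<Sum>p\<in>UNIV. \<Sum>q\<in>UNIV. cc e p q * (mean_cartan_up L p y * pd e L y * y $ q)) * y $ r"
      unfolding sum_distrib_left sum_distrib_right sum.distrib[symmetric]
      by (intro sum.cong refl) (simp add: douglas_potential_def algebra_simps)
    have "H r y = (\<Sum>e\<in>UNIV. \<Sum>p\<in>UNIV. \<Sum>q\<in>UNIV. cc e p q * douglas_potential L r p e q y)
        + (\<Sum>p\<in>UNIV. \<Sum>q\<in>UNIV. Q r p q * (y $ p * y $ q))"
      unfolding H_def divergence_frame_spray[OF y cc_antisym] \<kappa>_def[symmetric] Q pot_eq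
      unfolding frame_spray_def by (simp add: algebra_simps)
    then show ?thesis
      by (simp add: P_def R_def sum_UNIV_pair)
  qed
  have P3: "Ck_on 3 (P r t) W" for r t using pot by (cases t) (simp add: P_def)
  have R3: "Ck_on 3 (R t) W" for t using Ck_on_nth_mult[OF open_W] by (cases t) (simp add: R_def)
  let ?cc = "\<lambda>(e, p, q). cc e p q"
  have Hsum: "Ck_on 3 (\<lambda>y. (\<Sum>t\<in>UNIV. ?cc t * P r t y) + (\<Sum>t\<in>UNIV. (case t of (p, q) \<Rightarrow> Q r p q) * R t y)) W" for r
    by (intro Ck_on_add Ck_on_sum Ck_on_cmult P3 R3 open_W) auto
  have H3: "Ck_on 3 (H r) W" for r
    by (rule Ck_on_cong[OF open_W _ Hsum]) (simp only: H_eq)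
  \<comment> \<open>The factor \<open>z^\<rho>\<close> is itself \<open>E\<close> applied to
    \<open>B z\<close>, so the trace correction takes the same shape
    \<open>E^\<rho>_r (...)^r\<close> as the spray.\<close>
  have conn: "spray F \<rho> x z - ?k * (\<Sum>\<mu>\<in>UNIV. nonlinear_conn F \<mu> \<mu> x z) * z $ \<rho>
      = (\<Sum>r\<in>UNIV. E $ \<rho> $ r * H r (B x *v z))" if "B x *v z \<in> W" for \<rho> z
  proof -
    have "?k * (\<Sum>\<mu>\<in>UNIV. nonlinear_conn F \<mu> \<mu> x z) * z $ \<rho>
        = (\<Sum>r\<in>UNIV. E $ \<rho> $ r * (?k * (\<Sum>s\<in>UNIV. pd s (frame_spray cc K s) (B x *v z)) * (B x *v z) $ r))"
      unfolding trace_nonlinear_conn[OF that] E_apply[of \<rho> z, symmetric] sum_distrib_left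
      by (simp only: mult_ac)
    then show ?thesis
      unfolding H_def spray_F[OF that] right_diff_distrib sum_subtractf by simp
  qed
  have "douglas F \<rho> \<alpha> \<beta> \<gamma> x u
      = pd \<alpha> (pd \<beta> (pd \<gamma> (\<lambda>z. \<Sum>r\<in>UNIV. E $ \<rho> $ r * H r (B x *v z)))) u" for \<rho> \<alpha> \<beta> \<gamma>
    unfolding douglas_def by (rule pd_cong3[OF open_fibre]) (use u conn in auto)
  then have "douglas_frame F E (B x) r a b c x u = pd a (pd b (pd c (H r))) (B x *v u)"
    unfolding douglas_frame_def
    using third_derivatives_tensorial[OF open_W u H3 matrix_inv(1)[OF B_inv]] by simp
  \<comment> \<open>Potentials and monomials are merged into a single family indexed by a sum type,
    so that linearity is used once; the \<open>Inr\<close> terms then vanish by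
    \<open>pd3_nth_mult\<close>.\<close>
  also have "\<dots> = pd a (pd b (pd c (\<lambda>y. \<Sum>t\<in>UNIV.
      (case t of Inl t \<Rightarrow> ?cc t | Inr (p, q) \<Rightarrow> Q r p q) * (case t of Inl t \<Rightarrow> P r t | Inr t \<Rightarrow> R t) y))) (B x *v u)"
    by (rule pd_cong3[OF open_W u])
       (simp add: H_eq UNIV_Plus_UNIV[symmetric] sum.Plus del: UNIV_Plus_UNIV)
  also have "\<dots> = (\<Sum>t\<in>UNIV. (case t of Inl t \<Rightarrow> ?cc t | Inr (p, q) \<Rightarrow> Q r p q) *
      pd a (pd b (pd c (case t of Inl t \<Rightarrow> P r t | Inr t \<Rightarrow> R t))) (B x *v u))"
    by (rule pd3_linear_combination[OF open_W u]) (auto simp: P3 R3 split: sum.split)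
  also have "\<dots> = (\<Sum>t\<in>UNIV. ?cc t * pd a (pd b (pd c (P r t))) (B x *v u))"
    by (simp add: UNIV_Plus_UNIV[symmetric] sum.Plus R_def pd3_nth_mult case_prod_beta del: UNIV_Plus_UNIV)
  also have "\<dots> = (\<Sum>e\<in>UNIV. \<Sum>p\<in>UNIV. \<Sum>q\<in>UNIV.
        cc e p q * pd a (pd b (pd c (douglas_potential L r p e q))) (B x *v u))"
    by (simp add: P_def sum_UNIV_pair)
  finally show ?thesis .
qed

end


section \<open>Tangent vectors in charts\<close>

locale smooth_atlas =
  fixes M :: "'p topology" and A :: "('p, 'm::finite) chart set"
  assumes smooth: "smooth_manifold M A"
begin

lemma chart_domain:
  assumes "c \<in> A"
  shows "openin M (fst c)" "open (snd c ` fst c)" "fst c \<subseteq> topspace M"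
    "homeomorphic_map (subtopology M (fst c)) (top_of_set (snd c ` fst c)) (snd c)"
  using smooth assms by (auto simp: smooth_manifold_def dest: openin_subset)

lemma chart_inj: "c \<in> A \<Longrightarrow> inj_on (snd c) (fst c)"
  using homeomorphic_imp_injective_map[OF chart_domain(4)[of c]] chart_domain(3)[of c]
  by (simp add: Int_absorb1)

lemma chart_inv_apply [simp]: "c \<in> A \<Longrightarrow> p \<in> fst c \<Longrightarrow> chart_inv c (snd c p) = p"
  using chart_inj by (simp add: inv_into_f_f)

lemma open_chart_image:
  assumes c: "c \<in> A" and U: "openin M U"
  shows "open (snd c ` (fst c \<inter> U))"
proof -
  have "openin (subtopology M (fst c)) (fst c \<inter> U)"
    using U by (simp add: openin_subtopology_Int2)
  then have "openin (top_of_set (snd c ` fst c)) (snd c ` (fst c \<inter> U))"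
    using homeomorphic_imp_open_map[OF chart_domain(4)[OF c]] by (simp add: open_map_def)
  then show ?thesis using chart_domain(2)[OF c] openin_open_trans by blast
qed

lemma transition_apply: "c \<in> A \<Longrightarrow> p \<in> fst c \<Longrightarrow> transition c d (snd c p) = snd d p"
  by (simp add: transition_def)

lemma transition_has_derivative:
  assumes "c \<in> A" "d \<in> A" "p \<in> fst c" "p \<in> fst d"
  shows "(transition c d has_derivative frechet_derivative (transition c d) (at (snd c p))) (at (snd c p))"
proof -
  have "Ck_on (Suc 0) (transition c d) (snd c ` (fst c \<inter> fst d))"
    using smooth assms(1,2) unfolding smooth_manifold_def by blast
  then show ?thesis by (rule Ck_on_has_derivative) (use assms in blast)
qed

text \<open>The cocycle law of coordinate changes. It makes the components assigned by
  \<open>tangent_of\<close> obey the transformation law between any two charts, not only out of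
  \<open>c\<close>.\<close>

lemma transition_chain:
  assumes "c \<in> A" "d \<in> A" "e \<in> A" "p \<in> fst c" "p \<in> fst d" "p \<in> fst e"
  shows "frechet_derivative (transition c e) (at (snd c p)) u =
    frechet_derivative (transition d e) (at (snd d p)) (frechet_derivative (transition c d) (at (snd c p)) u)"
proof -
  let ?D = "\<lambda>u. frechet_derivative (transition d e) (at (snd d p)) (frechet_derivative (transition c d) (at (snd c p)) u)"
  have "((\<lambda>\<xi>. transition d e (transition c d \<xi>)) has_derivative ?D) (at (snd c p))"
    using has_derivative_compose[OF transition_has_derivative[of c d p], of "transition d e"]
      transition_has_derivative[of d e p] assms by (simp add: transition_apply)
  moreover have "open (snd c ` (fst c \<inter> fst d))" by (intro open_chart_image chart_domain assms)
  moreover have "transition d e (transition c d \<xi>) = transition c e \<xi>" if "\<xi> \<in> snd c ` (fst c \<inter> fst d)" for \<xi>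
    using that assms by (auto simp: transition_apply)
  ultimately have "(transition c e has_derivative ?D) (at (snd c p))"
    using assms by (elim has_derivative_transform_within_open) auto
  from frechet_derivative_at[OF this] show ?thesis by metis
qed

lemma tangent_of_in_tangent_space:
  assumes "c \<in> A" "p \<in> fst c"
  shows "tangent_of A c p u \<in> tangent_space A p"
  unfolding tangent_space_def
proof (intro CollectI conjI ballI impI allI)
  fix d e assume "d \<in> A" "e \<in> A" "p \<in> fst d" "p \<in> fst e"
  then show "tangent_of A c p u e = frechet_derivative (transition d e) (at (snd d p)) (tangent_of A c p u d)"
    using transition_chain[OF assms(1) \<open>d \<in> A\<close> \<open>e \<in> A\<close> assms(2), of u] by (simp add: tangent_of_def)
next
  fix d assume "\<not> (d \<in> A \<and> p \<in> fst d)"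
  then show "tangent_of A c p u d = 0" by (auto simp: tangent_of_def)
qed

lemma tangent_of_tangent:
  assumes "c \<in> A" "p \<in> fst c" "v \<in> tangent_space A p"
  shows "tangent_of A c p (v c) = v"
proof
  fix d show "tangent_of A c p (v c) d = v d"
  proof (cases "d \<in> A \<and> p \<in> fst d")
    case True
    then have "v d = frechet_derivative (transition c d) (at (snd c p)) (v c)"
      using assms unfolding tangent_space_def by blast
    with True show ?thesis by (simp only: tangent_of_def if_True simp_thms)
  next
    case False
    then have "v d = 0" using assms(3) unfolding tangent_space_def by blast
    with False show ?thesis by (auto simp: tangent_of_def)
  qed
qed

lemma tangent_of_linear:
  assumes "c \<in> A" "p \<in> fst c"
  shows "tangent_of A c p (s *\<^sub>R u + t *\<^sub>R w) = (\<lambda>d. s *\<^sub>R tangent_of A c p u d + t *\<^sub>R tangent_of A c p w d)"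
proof
  fix d
  have "linear (frechet_derivative (transition c d) (at (snd c p)))" if "d \<in> A" "p \<in> fst d"
    using transition_has_derivative[OF assms(1) that(1) assms(2) that(2)] by (rule has_derivative_linear)
  then show "tangent_of A c p (s *\<^sub>R u + t *\<^sub>R w) d = s *\<^sub>R tangent_of A c p u d + t *\<^sub>R tangent_of A c p w d"
    by (simp add: tangent_of_def linear_add linear_cmul)
qed

end

section \<open>The model Lagrangian in components with respect to a basis\<close>

lemma linear_lin_comb: "linear (lin_comb e)"
  by (rule linearI) (simp_all add: lin_comb_def scaleR_add_left sum.distrib scaleR_sum_right)

lemma lin_comb_axis: "lin_comb e (axis a 1) = e a"
proof -
  have "lin_comb e (axis a 1) = (\<Sum>b\<in>UNIV. if b = a then e b else 0)"
    unfolding lin_comb_def by (rule sum.cong) (auto simp: axis_def)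
  then show ?thesis by simp
qed

lemma bij_lin_comb:
  fixes e :: "'m::finite \<Rightarrow> 'v::euclidean_space"
  assumes "is_basis e"
  shows "bij (lin_comb e)"
proof (rule bijI)
  have e: "inj e" "independent (range e)" "span (range e) = UNIV"
    using assms by (auto simp: is_basis_def)
  show "inj (lin_comb e)"
    unfolding linear_injective_0[OF linear_lin_comb]
  proof (intro allI impI)
    fix y assume "lin_comb e y = 0"
    then have "(\<Sum>v\<in>range e. y $ inv e v *\<^sub>R v) = 0"
      using e(1) by (simp add: lin_comb_def sum.reindex)
    then have "y $ inv e v = 0" if "v \<in> range e" for v
      using independentD[OF e(2) _ order_refl _ that] by simp
    then have "y $ a = 0" for a using inv_f_f[OF e(1), of a] by (metis rangeI)
    then show "y = 0" by (simp add: vec_eq_iff)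
  qed
  show "surj (lin_comb e)"
  proof -
    have "subspace (range (lin_comb e))" by (intro linear_subspace_image linear_lin_comb subspace_UNIV)
    moreover have "range e \<subseteq> range (lin_comb e)" by (metis lin_comb_axis image_subsetI rangeI)
    ultimately show ?thesis using span_minimal e(3) by blast
  qed
qed

lemma dir_deriv_compose_linear:
  assumes T: "bounded_linear T" and f: "f differentiable (at (T y))"
  shows "dir_deriv v (\<lambda>y. f (T y)) y = dir_deriv (T v) f (T y)"
  using dir_deriv_eq[OF has_derivative_compose[OF bounded_linear_imp_has_derivative[OF T] frechet_derivative_works[THEN iffD1, OF f]]]
  by (simp add: dir_deriv_def)

lemma hessian_compose_linear:
  assumes T: "bounded_linear T" and S: "open S" "T y \<in> S" and f: "Ck_on 2 f S"
  shows "hessian (\<lambda>y. f (T y)) y u w = hessian f (T y) (T u) (T w)"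
proof -
  have f2: "Ck_on (Suc (Suc 0)) f S" using f by (simp only: numeral_2_eq_2)
  have op: "open (T -` S)"
    using T S(1) by (intro open_vimage linear_continuous_on) auto
  have "dir_deriv u (dir_deriv w (\<lambda>y. f (T y))) y = dir_deriv u (\<lambda>y. dir_deriv (T w) f (T y)) y"
    by (rule dir_deriv_cong[OF op])
      (use S in \<open>auto intro!: dir_deriv_compose_linear[OF T] Ck_on_differentiable[OF f2]\<close>)
  also have "\<dots> = dir_deriv (T u) (dir_deriv (T w) f) (T y)"
    by (rule dir_deriv_compose_linear[OF T Ck_on_differentiable[OF Ck_on_dir_deriv[OF f2]]]) (use S in auto)
  finally show ?thesis by (simp add: hessian_def)
qed

lemma dir_deriv_pd:
  "f differentiable (at x) \<Longrightarrow> dir_deriv v f x = (\<Sum>i\<in>UNIV. pd i f x * v $ i)"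
  by (rule dir_deriv_eq[OF has_derivative_pd])

lemma hessian_metric:
  assumes S: "open S" "y \<in> S" and f: "Ck_on 2 f S"
  shows "hessian f y u w = (\<Sum>a\<in>UNIV. \<Sum>b\<in>UNIV. metric f y $ a $ b * w $ b * u $ a)"
proof -
  have f2: "Ck_on (Suc (Suc 0)) f S" using f by (simp only: numeral_2_eq_2)
  have d: "pd b f differentiable (at y)" for b
    using Ck_on_differentiable[OF Ck_on_pd[OF f2] _ S(2)] by simp
  have "hessian f y u w = dir_deriv u (\<lambda>y. \<Sum>b\<in>UNIV. w $ b * pd b f y) y"
    unfolding hessian_def
    by (rule dir_deriv_cong[OF S]) (simp add: dir_deriv_pd Ck_on_differentiable[OF f2] mult.commute)
  also have "\<dots> = (\<Sum>a\<in>UNIV. pd a (\<lambda>y. \<Sum>b\<in>UNIV. w $ b * pd b f y) y * u $ a)"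
    by (rule dir_deriv_pd) (simp add: d)
  finally show ?thesis
    by (simp add: pd_sum pd_cmult d metric_def sum_distrib_left sum_distrib_right mult_ac)
qed

lemma frame_lagrangian_in_basis:
  fixes L :: "'v::euclidean_space \<Rightarrow> real" and e :: "'m::finite \<Rightarrow> 'v"
  assumes pm: "pseudo_minkowski \<omega> L" and e: "is_basis e"
  shows "frame_lagrangian (in_basis e L) {y. lin_comb e y \<in> \<omega>}"
proof
  let ?W = "{y. lin_comb e y \<in> \<omega>}"
  have T: "bounded_linear (lin_comb e)" using linear_lin_comb linear_conv_bounded_linear by blast
  have \<omega>: "open \<omega>" and L: "Ck_on 4 L \<omega>"
    and nondeg: "\<And>y u. y \<in> \<omega> \<Longrightarrow> (\<And>w. hessian L y u w = 0) \<Longrightarrow> u = 0"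
    using pm by (auto simp: pseudo_minkowski_def open_cone_def)
  show W: "open ?W" using open_vimage[OF \<omega>, of "lin_comb e"] T by (simp add: vimage_def linear_continuous_on)
  show L4: "Ck_on 4 (in_basis e L) ?W"
    using Ck_on_compose_linear[OF T \<omega> L] by (simp add: in_basis_def vimage_def)
  have L2: "Ck_on 2 L \<omega>"
    using L Ck_on_lower[of 3 L \<omega>] Ck_on_lower[of 2 L \<omega>] by (simp add: numeral_eq_Suc del: Ck_on.simps)
  fix y assume y: "y \<in> ?W"
  let ?g = "metric (in_basis e L) y"
  \<comment> \<open>Non-degeneracy speaks of the kernel in the first slot of the Hessian, which
    corresponds to the row index of \<open>?g\<close>; hence the transpose.\<close>
  have "z = 0" if z: "transpose ?g *v z = 0" for z
  proof -
    have "hessian L (lin_comb e y) (lin_comb e z) w = 0" for w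
    proof -
      obtain w' where w: "w = lin_comb e w'" using bij_lin_comb[OF e] by (metis bij_pointE)
      have "hessian L (lin_comb e y) (lin_comb e z) w = hessian (in_basis e L) y z w'"
        unfolding w in_basis_def by (rule hessian_compose_linear[OF T \<omega> _ L2, symmetric]) (use y in auto)
      also have "\<dots> = (\<Sum>a\<in>UNIV. \<Sum>b\<in>UNIV. ?g $ a $ b * w' $ b * z $ a)"
        by (rule hessian_metric[OF W y Ck_on_4_D(2)[OF L4]])
      also have "\<dots> = (\<Sum>b\<in>UNIV. w' $ b * (transpose ?g *v z) $ b)"
        by (subst sum.swap) (simp add: matrix_vector_mult_def transpose_def sum_distrib_left mult_ac)
      finally show ?thesis by (simp only: z) simp
    qed
    then have "lin_comb e z = 0" using nondeg[of "lin_comb e y"] y by blast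
    then show "z = 0"
      using bij_lin_comb[OF e] linear_injective_0[OF linear_lin_comb, of e] by (auto simp: bij_def)
  qed
  then have "invertible (transpose ?g)"
    using matrix_left_invertible_ker invertible_left_inverse by blast
  then show "invertible ?g" using transpose_invertible[of "transpose ?g"] by simp
qed


section \<open>The vierbein in a chart\<close>

text \<open>The matrix of \<open>\<phi>\<close> with respect to the coordinate fields of the chart \<open>k\<close> and the basis \<open>e\<close>,
  i.e. the coframe \<open>e\<^sup>a\<^sub>\<mu>\<close> as a function of the coordinates.\<close>

definition coframe_field :: "('p, 'm::finite) chart set \<Rightarrow> ('p \<Rightarrow> ('p, 'm) tangent \<Rightarrow> 'v::euclidean_space) \<Rightarrow>
    ('m \<Rightarrow> 'v) \<Rightarrow> ('p, 'm) chart \<Rightarrow> real^'m \<Rightarrow> real^'m^'m" where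
  "coframe_field A \<phi> e k \<xi> =
     matrix (\<lambda>u. inv (lin_comb e) (\<phi> (chart_inv k \<xi>) (tangent_of A k (chart_inv k \<xi>) u)))"

locale local_vierbein = smooth_atlas M A for M :: "'p topology" and A :: "('p, 'm::finite) chart set" +
  fixes \<Omega> :: "('p \<times> ('p, 'm) tangent) set" and \<L> :: "'p \<times> ('p, 'm) tangent \<Rightarrow> real"
    and \<omega> :: "'v::euclidean_space set" and L :: "'v \<Rightarrow> real"
    and U :: "'p set" and \<phi> :: "'p \<Rightarrow> ('p, 'm) tangent \<Rightarrow> 'v" and e :: "'m \<Rightarrow> 'v"
    and k :: "('p, 'm) chart"
  assumes tangent: "\<Omega> \<subseteq> tangent_bundle M A" and model: "local_model M A \<Omega> \<L> \<omega> L U \<phi>"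
    and basis: "is_basis e" and k: "k \<in> A"
begin

abbreviation B :: "real^'m \<Rightarrow> real^'m^'m" where "B \<equiv> coframe_field A \<phi> e k"
abbreviation S :: "(real^'m) set" where "S \<equiv> snd k ` (fst k \<inter> U)"

lemma lin_comb_eq_iff: "lin_comb e y = lin_comb e z \<longleftrightarrow> y = z"
  using bij_lin_comb[OF basis] by (auto simp: bij_def dest: injD)

lemma lin_comb_inv: "lin_comb e (inv (lin_comb e) v) = v"
  using bij_lin_comb[OF basis] by (simp add: bij_def surj_f_inv_f)

lemma linear_inv_lin_comb: "linear (inv (lin_comb e))"
proof (rule linearI)
  show "inv (lin_comb e) (v + w) = inv (lin_comb e) v + inv (lin_comb e) w" for v w
    using lin_comb_eq_iff linear_add[OF linear_lin_comb[of e]] lin_comb_inv by metis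
  show "inv (lin_comb e) (t *\<^sub>R v) = t *\<^sub>R inv (lin_comb e) v" for t v
    using lin_comb_eq_iff linear_cmul[OF linear_lin_comb[of e]] lin_comb_inv by metis
qed

lemma iso: "p \<in> U \<Longrightarrow> tangent_iso A p (\<phi> p)"
  using model by (simp add: local_model_def)

text \<open>\<open>coframe_field\<close> is formed by \<open>matrix\<close>, which represents a map
  only if it is linear; linearity comes from that of \<open>\<phi> p\<close> on the tangent space
  and of \<open>tangent_of\<close> in the components.\<close>

lemma lin_comb_B:
  assumes p: "p \<in> U" "p \<in> fst k"
  shows "lin_comb e (B (snd k p) *v u) = \<phi> p (tangent_of A k p u)"
proof -
  have comb: "\<phi> p (tangent_of A k p (s *\<^sub>R u + t *\<^sub>R w))
      = s *\<^sub>R \<phi> p (tangent_of A k p u) + t *\<^sub>R \<phi> p (tangent_of A k p w)" for s t u w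
    using iso[OF p(1)] tangent_of_in_tangent_space[OF k p(2)]
    by (simp add: tangent_iso_def tangent_of_linear[OF k p(2)])
  have "linear (\<lambda>u. \<phi> p (tangent_of A k p u))"
  proof (rule linearI)
    show "\<phi> p (tangent_of A k p (u + w)) = \<phi> p (tangent_of A k p u) + \<phi> p (tangent_of A k p w)" for u w
      using comb[of 1 u 1 w] by simp
    show "\<phi> p (tangent_of A k p (t *\<^sub>R u)) = t *\<^sub>R \<phi> p (tangent_of A k p u)" for t u
      using comb[of t u 0 u] by simp
  qed
  then have "linear (\<lambda>u. inv (lin_comb e) (\<phi> p (tangent_of A k p u)))"
    using linear_compose[OF _ linear_inv_lin_comb] by (simp add: o_def)
  from fun_cong[OF matrix_vector_mul(2)[OF this], of u] show ?thesis
    by (simp add: coframe_field_def k p lin_comb_inv)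
qed

text \<open>The columns of the frame matrix are the vectors that \<open>\<phi> p\<close> sends to
  the basis \<open>e\<close>, so \<open>B\<close>, which is \<open>\<phi> p\<close> in components,
  sends them to the standard unit vectors.\<close>

lemma B_frame_mat:
  assumes p: "p \<in> U" "p \<in> fst k"
  shows "B (snd k p) ** frame_mat A \<phi> e k p = mat 1"
proof -
  have "B (snd k p) *v (frame A \<phi> e a p k) = axis a 1" for a
  proof -
    have bij: "bij_betw (\<phi> p) (tangent_space A p) UNIV" using iso[OF p(1)] by (simp add: tangent_iso_def)
    then have "frame A \<phi> e a p \<in> tangent_space A p" "\<phi> p (frame A \<phi> e a p) = e a"
      unfolding frame_def by (auto simp: bij_betw_def f_inv_into_f intro: inv_into_into)
    then have "lin_comb e (B (snd k p) *v (frame A \<phi> e a p k)) = lin_comb e (axis a 1)"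
      by (simp add: lin_comb_B[OF p] tangent_of_tangent[OF k p(2)] lin_comb_axis)
    then show ?thesis by (simp only: lin_comb_eq_iff)
  qed
  from arg_cong[OF this, of "\<lambda>v. v $ b" for b] show ?thesis
    by (simp add: vec_eq_iff matrix_matrix_mult_def matrix_vector_mult_def frame_mat_def mat_def axis_def)
qed

lemma frame_mat_eq: "p \<in> U \<Longrightarrow> p \<in> fst k \<Longrightarrow> frame_mat A \<phi> e k p = matrix_inv (B (snd k p))"
  using matrix_inv_eqI[OF B_frame_mat] by simp

lemma coframe_mat_eq: "p \<in> U \<Longrightarrow> p \<in> fst k \<Longrightarrow> coframe_mat A \<phi> e k p = B (snd k p)"
  unfolding coframe_mat_def
  by (intro matrix_inv_eqI) (use B_frame_mat matrix_left_right_inverse in blast)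

lemma invertible_B: "\<xi> \<in> S \<Longrightarrow> invertible (B \<xi>)"
  using B_frame_mat invertible_right_inverse by blast

lemma open_S: "open S"
  using open_chart_image[OF k] model by (simp add: local_model_def)

text \<open>The entry is the component \<open>a\<close> of the image under \<open>\<phi>\<close> of
  the coordinate field \<sigma>, that is, the C^1 condition of \<open>local_model\<close> for the
  constant components \<open>axis \<sigma> 1\<close>.\<close>

lemma B_differentiable:
  assumes "\<xi> \<in> S"
  shows "(\<lambda>\<xi>. B \<xi> $ a $ \<sigma>) differentiable (at \<xi>)"
proof -
  let ?f = "\<lambda>\<xi>. \<phi> (chart_inv k \<xi>) (tangent_of A k (chart_inv k \<xi>) (axis \<sigma> 1))"
  have "Ck_on 1 ?f S" using model k by (simp add: local_model_def del: One_nat_def)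
  then have "?f differentiable (at \<xi>)" by (rule Ck_on_differentiable) (use assms in auto)
  then obtain D where "(?f has_derivative D) (at \<xi>)" by (auto simp: differentiable_def)
  moreover have "bounded_linear (\<lambda>v. inv (lin_comb e) v $ a)"
    using linear_inv_lin_comb linear_conv_bounded_linear bounded_linear_compose[OF bounded_linear_vec_nth] by blast
  ultimately have "((\<lambda>\<xi>. inv (lin_comb e) (?f \<xi>) $ a) has_derivative (\<lambda>h. inv (lin_comb e) (D h) $ a)) (at \<xi>)"
    using bounded_linear.has_derivative by fast
  then show ?thesis by (auto simp: coframe_field_def matrix_def intro: differentiableI)
qed

lemma fibre_tangent: "v \<in> fibre \<Omega> p \<Longrightarrow> v \<in> tangent_space A p"
  using tangent by (auto simp: fibre_def tangent_bundle_def)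

text \<open>The model identity is available only for vectors in the closure of the fibre of
  \<Omega>. Since \<open>\<phi> p\<close> maps that fibre onto \<omega> and is injective on the
  whole tangent space, a vector with image in \<omega> already belongs to the fibre.\<close>

lemma coord_fun_eq:
  assumes "\<xi> \<in> S" "lin_comb e (B \<xi> *v u) \<in> \<omega>"
  shows "coord_fun A \<L> k \<xi> u = in_basis e L (B \<xi> *v u)"
proof -
  obtain p where p: "p \<in> U" "p \<in> fst k" and \<xi>: "\<xi> = snd k p" using assms(1) by blast
  let ?v = "tangent_of A k p u"
  have "\<phi> p ?v \<in> \<phi> p ` fibre \<Omega> p"
    using assms(2) model p(1) unfolding \<xi> lin_comb_B[OF p] by (simp add: local_model_def)
  then obtain v where v: "v \<in> fibre \<Omega> p" "\<phi> p ?v = \<phi> p v" by blast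
  have "?v = v"
    using iso[OF p(1)] v fibre_tangent[OF v(1)] tangent_of_in_tangent_space[OF k p(2), of u]
    by (auto simp: tangent_iso_def bij_betw_def dest: inj_onD)
  with v have "?v \<in> tangent_closure A p (fibre \<Omega> p)"
    using fibre_tangent closure_subset by (fastforce simp: tangent_closure_def)
  then have "L (\<phi> p ?v) = \<L> (p, ?v)" using model p(1) by (simp add: local_model_def)
  then show ?thesis by (simp add: coord_fun_def in_basis_def \<xi> lin_comb_B[OF p] k p)
qed

text \<open>The frame is the inverse of \<open>B\<close>, so its derivatives are
  \<open>- E (dB) E\<close>. The factor \<open>E\<close> on the left is common to both terms of the
  Lie bracket and to the expansion in the frame, and multiplication by \<open>B\<close> removes
  it.\<close>

lemma commutation_coeffs_eq:
  assumes cc: "commutation_coeffs A U \<phi> e cc" and x: "x \<in> U" "x \<in> fst k"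
  shows "cc x f a b = (\<Sum>\<sigma>\<in>UNIV. \<Sum>\<rho>\<in>UNIV.
    matrix_inv (B (snd k x)) $ \<sigma> $ a * matrix_inv (B (snd k x)) $ \<rho> $ b *
      (pd \<rho> (\<lambda>\<xi>. B \<xi> $ f $ \<sigma>) (snd k x) - pd \<sigma> (\<lambda>\<xi>. B \<xi> $ f $ \<rho>) (snd k x)))"
proof -
  let ?\<xi> = "snd k x"
  let ?E = "matrix_inv (B ?\<xi>)"
  let ?d = "\<lambda>\<nu> e \<sigma>. pd \<nu> (\<lambda>\<xi>. B \<xi> $ e $ \<sigma>) ?\<xi>"
  have \<xi>: "?\<xi> \<in> S" using x by blast
  define C where "C f = (\<Sum>\<sigma>\<in>UNIV. \<Sum>\<rho>\<in>UNIV. ?E $ \<sigma> $ a * ?E $ \<rho> $ b * (?d \<rho> f \<sigma> - ?d \<sigma> f \<rho>))" for f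
  have frame: "frame A \<phi> e a x k $ \<mu> = ?E $ \<mu> $ a" for a \<mu>
    using frame_mat_eq[OF x] by (simp add: frame_mat_def vec_eq_iff)
  have dframe: "pd \<nu> (\<lambda>\<xi>. frame A \<phi> e a (chart_inv k \<xi>) k $ \<mu>) ?\<xi>
      = - (\<Sum>f\<in>UNIV. \<Sum>\<sigma>\<in>UNIV. ?E $ \<mu> $ f * ?d \<nu> f \<sigma> * ?E $ \<sigma> $ a)" for \<nu> a \<mu>
  proof -
    have "frame A \<phi> e a (chart_inv k \<xi>) k $ \<mu> = matrix_inv (B \<xi>) $ \<mu> $ a" if "\<xi> \<in> S" for \<xi>
      using that frame_mat_eq k by (auto simp: frame_mat_def vec_eq_iff)
    from pd_cong[OF open_S \<xi> this] show ?thesis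
      by (simp add: pd_matrix_inv[OF open_S \<xi> invertible_B B_differentiable[OF \<xi>]])
  qed
  have "(\<Sum>f\<in>UNIV. ?E $ \<mu> $ f * cc x f a b) = (\<Sum>f\<in>UNIV. ?E $ \<mu> $ f * C f)" for \<mu>
  proof -
    have "(\<Sum>f\<in>UNIV. ?E $ \<mu> $ f * cc x f a b) = (\<Sum>f\<in>UNIV. cc x f a b *\<^sub>R frame A \<phi> e f x k) $ \<mu>"
      by (simp add: frame mult.commute)
    also have "\<dots> = lie_bracket A (frame A \<phi> e a) (frame A \<phi> e b) x k $ \<mu>"
      using cc x(1) unfolding commutation_coeffs_def by simp
    also have "\<dots> = (\<Sum>\<nu>\<in>UNIV. ?E $ \<nu> $ a * - (\<Sum>f\<in>UNIV. \<Sum>\<sigma>\<in>UNIV. ?E $ \<mu> $ f * ?d \<nu> f \<sigma> * ?E $ \<sigma> $ b)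
        - ?E $ \<nu> $ b * - (\<Sum>f\<in>UNIV. \<Sum>\<sigma>\<in>UNIV. ?E $ \<mu> $ f * ?d \<nu> f \<sigma> * ?E $ \<sigma> $ a))"
      using k x(2) by (simp add: lie_bracket_def frame dframe)
    also have "\<dots> = (\<Sum>\<nu>\<in>UNIV. \<Sum>f\<in>UNIV. ?E $ \<mu> $ f *
        ((\<Sum>\<sigma>\<in>UNIV. ?E $ \<sigma> $ a * ?E $ \<nu> $ b * ?d \<nu> f \<sigma>) - (\<Sum>\<sigma>\<in>UNIV. ?E $ \<nu> $ a * ?E $ \<sigma> $ b * ?d \<nu> f \<sigma>)))"
      by (simp add: sum_distrib_left sum_subtractf[symmetric] sum_negf right_diff_distrib mult_ac)
    also have "\<dots> = (\<Sum>f\<in>UNIV. \<Sum>\<nu>\<in>UNIV. ?E $ \<mu> $ f *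
        ((\<Sum>\<sigma>\<in>UNIV. ?E $ \<sigma> $ a * ?E $ \<nu> $ b * ?d \<nu> f \<sigma>) - (\<Sum>\<sigma>\<in>UNIV. ?E $ \<nu> $ a * ?E $ \<sigma> $ b * ?d \<nu> f \<sigma>)))"
      by (rule sum.swap)
    also have "\<dots> = (\<Sum>f\<in>UNIV. ?E $ \<mu> $ f * C f)"
    proof (rule sum.cong[OF refl])
      fix f
      \<comment> \<open>In \<open>C\<close> the derivative index is \<rho> in one term and \<sigma>
        in the other, whereas it is \<nu> in both terms here; exchanging the sums in the first term
        matches the two.\<close>
      have "(\<Sum>\<nu>\<in>UNIV. \<Sum>\<sigma>\<in>UNIV. ?E $ \<sigma> $ a * ?E $ \<nu> $ b * ?d \<nu> f \<sigma>) = (\<Sum>\<sigma>\<in>UNIV. \<Sum>\<nu>\<in>UNIV. ?E $ \<sigma> $ a * ?E $ \<nu> $ b * ?d \<nu> f \<sigma>)"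
        by (rule sum.swap)
      then show "(\<Sum>\<nu>\<in>UNIV. ?E $ \<mu> $ f *
          ((\<Sum>\<sigma>\<in>UNIV. ?E $ \<sigma> $ a * ?E $ \<nu> $ b * ?d \<nu> f \<sigma>) - (\<Sum>\<sigma>\<in>UNIV. ?E $ \<nu> $ a * ?E $ \<sigma> $ b * ?d \<nu> f \<sigma>)))
          = ?E $ \<mu> $ f * C f"
        unfolding C_def sum_distrib_left[symmetric] sum_subtractf right_diff_distrib by (simp only:)
    qed
    finally show ?thesis .
  qed
  then have "?E *v (\<chi> f. cc x f a b) = ?E *v (\<chi> f. C f)"
    by (simp add: matrix_vector_mult_def vec_eq_iff)
  then have "B ?\<xi> *v (?E *v (\<chi> f. cc x f a b)) = B ?\<xi> *v (?E *v (\<chi> f. C f))" by simp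
  then have "(\<chi> f. cc x f a b) = (\<chi> f. C f)"
    by (simp only: matrix_vector_mul_assoc matrix_inv[OF invertible_B[OF \<xi>]] matrix_vector_mul_lid)
  then show ?thesis by (simp add: vec_eq_iff C_def)
qed

end

section \<open>The Douglas curvature of a modeled space in vierbein components\<close>

theorem mainTheorem5:
  fixes M :: "'p topology" and A :: "('p, 'm::finite) chart set"
    and \<Omega> :: "('p \<times> ('p, 'm) tangent) set" and \<L> :: "'p \<times> ('p, 'm) tangent \<Rightarrow> real"
    and \<omega> :: "'v::euclidean_space set" and L :: "'v \<Rightarrow> real"
    and U :: "'p set" and \<phi> :: "'p \<Rightarrow> ('p, 'm) tangent \<Rightarrow> 'v"
    and et :: "'m \<Rightarrow> 'v" and cc :: "'p \<Rightarrow> 'm \<Rightarrow> 'm \<Rightarrow> 'm \<Rightarrow> real"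
  assumes "pseudo_minkowski \<omega> L"
    and "pseudo_finsler M A \<Omega> \<L>"
    and "modeled_on M A \<Omega> \<L> \<omega> L"
    and "local_model M A \<Omega> \<L> \<omega> L U \<phi>"
    and "is_basis et"
    and "commutation_coeffs A U \<phi> et cc"
    (* the third derivatives in the conclusion exist and are continuous; this holds if L is C^6,
       while C^4 alone does not ensure that the Douglas curvature is defined *)
    and "\<And>r p e q. Ck_on 3 (douglas_potential (in_basis et L) r p e q) {y. lin_comb et y \<in> \<omega>}"
    and "x \<in> U" and "k \<in> A" and "x \<in> fst k" and "(x, y) \<in> \<Omega>"
  shows "douglas_frame (coord_fun A \<L> k) (frame_mat A \<phi> et k x) (coframe_mat A \<phi> et k x)
           r a b c (snd k x) (y k)
       = (\<Sum>e\<in>UNIV. \<Sum>p\<in>UNIV. \<Sum>q\<in>UNIV. cc x e p q *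
           pd a (pd b (pd c (douglas_potential (in_basis et L) r p e q))) (coframe_mat A \<phi> et k x *v y k))"
proof -
  note x = \<open>x \<in> U\<close> \<open>x \<in> fst k\<close>
  interpret V: local_vierbein M A \<Omega> \<L> \<omega> L U \<phi> et k
    by unfold_locales (use assms in \<open>auto simp: pseudo_finsler_def\<close>)
  interpret frame_lagrangian "in_basis et L" "{y. lin_comb et y \<in> \<omega>}"
    using assms(1,5) by (rule frame_lagrangian_in_basis)
  interpret moving_frame "in_basis et L" "{y. lin_comb et y \<in> \<omega>}" "coord_fun A \<L> k" V.B V.S "snd k x" "cc x"
  proof
    show "open V.S" by (rule V.open_S)
    show "snd k x \<in> V.S" using x by blast
    then show "invertible (V.B (snd k x))" by (rule V.invertible_B)
    show "(\<lambda>\<xi>. V.B \<xi> $ a $ \<sigma>) differentiable (at \<xi>)" if "\<xi> \<in> V.S" for \<xi> a \<sigma>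
      using that by (rule V.B_differentiable)
    show "coord_fun A \<L> k \<xi> u = in_basis et L (V.B \<xi> *v u)"
      if "\<xi> \<in> V.S" "V.B \<xi> *v u \<in> {y. lin_comb et y \<in> \<omega>}" for \<xi> u
      using that by (intro V.coord_fun_eq) auto
  qed (rule V.commutation_coeffs_eq[OF assms(6) x])
  \<comment> \<open>The point of evaluation lies in the cone: by \<open>lin_comb_B\<close> its
    coordinates are those of \<open>\<phi> x y\<close>, and \<open>\<phi> x\<close> maps the fibre
    onto \<omega>.\<close>
  have "y \<in> fibre \<Omega> x" using \<open>(x, y) \<in> \<Omega>\<close> by (simp add: fibre_def)
  then have "lin_comb et (V.B (snd k x) *v y k) = \<phi> x y" "\<phi> x y \<in> \<omega>"
    using V.lin_comb_B[OF x] V.tangent_of_tangent[OF \<open>k \<in> A\<close> x(2) V.fibre_tangent] V.model x(1)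
    by (auto simp: local_model_def)
  then have "V.B (snd k x) *v y k \<in> {y. lin_comb et y \<in> \<omega>}" by simp
  from douglas_frame_F[OF assms(7) this] show ?thesis
    by (simp only: V.frame_mat_eq[OF x] V.coframe_mat_eq[OF x])
qed

end
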